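(* Let $E$ and $F$ be Banach spaces with $F\neq\{0\}$ and let $n\ge1$. If $\mathcal P_w(^nE,F)$ is an $M$-ideal in $\mathcal P(^nE,F)$, then $n\le cd(E)$.
   Context: $\mathcal P(^nE,F)$ is the Banach space of continuous $n$-homogeneous polynomials $P:E\to F$ with norm $\|P\|=\sup_{\|x\|\le1}\|P(x)\|$; $\mathcal P(^nE)=\mathcal P(^nE,\mathbb K)$. $\mathcal P_w(^nE,F)$ is the subspace of polynomials that are weakly continuous on bounded sets: $\|P(x_\alpha)-P(x)\|\to0$ for every bounded net $(x_\alpha)$ converging weakly to $x\in E$; $\mathcal P_w(^nE)=\mathcal P_w(^nE,\mathbb K)$. The critical degree $cd(E)$ is the smallest $k\ge1$ such that $\mathcal P_w(^kE)\ne\mathcal P(^kE)$; if there is no such $k$, put $cd(E)=\infty$. A closed subspace $J$ of a Banach space $X$ is an $M$-ideal if there is a linear projection $\pi$ on $X^*$ with kernel $J^\perp$ such that $\|x^*\|=\|\pi(x^* )\|+\|x^*-\pi(x^* )\|$ for all $x^*\in X^*$. *)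

theory Defs
  imports "HOL-Analysis.Analysis" "HOL-Library.Function_Algebras" "HOL-Library.Extended_Nat"
begin

text \<open>The scalar field is \<open>\<real>\<close> or \<open>\<complex>\<close>: a normed field isometrically isomorphic to one of them.\<close>

class real_or_complex = real_normed_field +
  assumes real_or_complex:
    "\<exists>f :: 'a \<Rightarrow> complex. (\<forall>x y. f (x + y) = f x + f y) \<and> (\<forall>x y. f (x * y) = f x * f y) \<and>
       (\<forall>x. norm (f x) = norm x) \<and> (range f = \<real> \<or> range f = UNIV)"

instance real :: real_or_complex
  by standard (rule exI[of _ complex_of_real], auto simp: Reals_def)

instance complex :: real_or_complex
  by standard (rule exI[of _ "\<lambda>z. z"], auto)

text \<open>The class \<open>banach\<close> provides the norm, its completeness and the underlying real structure;
  \<open>scale\<close> is the multiplication by scalars of \<open>'k\<close>.\<close>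

locale banach_space_over = vector_space scale
  for scale :: "'k::real_or_complex \<Rightarrow> 'e::banach \<Rightarrow> 'e" +
  assumes scale_of_real: "scale (of_real r) x = r *\<^sub>R x"
    and norm_scale: "norm (scale c x) = norm c * norm x"


section \<open>Duals and M-ideals\<close>

text \<open>A normed space is given here by a carrier \<open>V\<close> (a subspace of an ambient vector space, with
  scalar multiplication \<open>sc\<close>) and a norm \<open>N\<close> which is only relevant on \<open>V\<close>. Functionals
  on \<open>V\<close> are set to \<open>0\<close> outside \<open>V\<close>, so that they are equal as HOL functions
  iff they agree on \<open>V\<close>.\<close>

definition dual_space ::
  "('k::real_or_complex \<Rightarrow> 'v::ab_group_add \<Rightarrow> 'v) \<Rightarrow> 'v set \<Rightarrow> ('v \<Rightarrow> real) \<Rightarrow> ('v \<Rightarrow> 'k) set" where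
  "dual_space sc V N = {\<phi>.
     (\<forall>u\<in>V. \<forall>v\<in>V. \<phi> (u + v) = \<phi> u + \<phi> v) \<and>
     (\<forall>c. \<forall>v\<in>V. \<phi> (sc c v) = c * \<phi> v) \<and>
     (\<exists>B. \<forall>v\<in>V. norm (\<phi> v) \<le> B * N v) \<and>
     (\<forall>v. v \<notin> V \<longrightarrow> \<phi> v = 0)}"

definition dual_norm :: "'v set \<Rightarrow> ('v \<Rightarrow> real) \<Rightarrow> ('v \<Rightarrow> 'k::real_or_complex) \<Rightarrow> real" where
  "dual_norm V N \<phi> = (SUP v\<in>{v \<in> V. N v \<le> 1}. norm (\<phi> v))"

definition annihilator ::
  "('k::real_or_complex \<Rightarrow> 'v::ab_group_add \<Rightarrow> 'v) \<Rightarrow> 'v set \<Rightarrow> ('v \<Rightarrow> real) \<Rightarrow> 'v set \<Rightarrow> ('v \<Rightarrow> 'k) set" where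
  "annihilator sc V N J = {\<phi> \<in> dual_space sc V N. \<forall>v\<in>J. \<phi> v = 0}"

definition closed_subspace ::
  "('k::real_or_complex \<Rightarrow> 'v::ab_group_add \<Rightarrow> 'v) \<Rightarrow> 'v set \<Rightarrow> ('v \<Rightarrow> real) \<Rightarrow> 'v set \<Rightarrow> bool" where
  "closed_subspace sc V N J \<longleftrightarrow> J \<subseteq> V \<and> module.subspace sc J \<and>
     (\<forall>u v. (\<forall>i::nat. u i \<in> J) \<and> v \<in> V \<and> (\<lambda>i. N (u i - v)) \<longlonglongrightarrow> 0 \<longrightarrow> v \<in> J)"

definition linear_projection_on_dual ::
  "('k::real_or_complex \<Rightarrow> 'v::ab_group_add \<Rightarrow> 'v) \<Rightarrow> 'v set \<Rightarrow> ('v \<Rightarrow> real) \<Rightarrow>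
     (('v \<Rightarrow> 'k) \<Rightarrow> ('v \<Rightarrow> 'k)) \<Rightarrow> bool" where
  "linear_projection_on_dual sc V N \<pi> \<longleftrightarrow>
     (\<forall>\<phi>\<in>dual_space sc V N. \<pi> \<phi> \<in> dual_space sc V N) \<and>
     (\<forall>\<phi>\<in>dual_space sc V N. \<forall>\<psi>\<in>dual_space sc V N. \<pi> (\<phi> + \<psi>) = \<pi> \<phi> + \<pi> \<psi>) \<and>
     (\<forall>c. \<forall>\<phi>\<in>dual_space sc V N. \<pi> (\<lambda>v. c * \<phi> v) = (\<lambda>v. c * \<pi> \<phi> v)) \<and>
     (\<forall>\<phi>\<in>dual_space sc V N. \<pi> (\<pi> \<phi>) = \<pi> \<phi>)"

definition M_ideal ::
  "('k::real_or_complex \<Rightarrow> 'v::ab_group_add \<Rightarrow> 'v) \<Rightarrow> 'v set \<Rightarrow> ('v \<Rightarrow> real) \<Rightarrow> 'v set \<Rightarrow> bool" where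
  "M_ideal sc V N J \<longleftrightarrow> closed_subspace sc V N J \<and>
     (\<exists>\<pi>. linear_projection_on_dual sc V N \<pi> \<and>
        {\<phi> \<in> dual_space sc V N. \<pi> \<phi> = 0} = annihilator sc V N J \<and>
        (\<forall>\<phi>\<in>dual_space sc V N.
           dual_norm V N \<phi> = dual_norm V N (\<pi> \<phi>) + dual_norm V N (\<phi> - \<pi> \<phi>)))"


section \<open>Homogeneous polynomials\<close>

text \<open>An \<open>n\<close>-linear map \<open>E\<^sup>n \<rightarrow> F\<close> is a function of sequences of vectors that depends
  only on the entries with index below \<open>n\<close>; without that clause the diagonal restriction
  below would be an arbitrary function.\<close>

definition multilinear ::
  "('k::real_or_complex \<Rightarrow> 'e::ab_group_add \<Rightarrow> 'e) \<Rightarrow> ('k \<Rightarrow> 'f::ab_group_add \<Rightarrow> 'f) \<Rightarrow> nat \<Rightarrow>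
     ((nat \<Rightarrow> 'e) \<Rightarrow> 'f) \<Rightarrow> bool" where
  "multilinear sE sF n A \<longleftrightarrow>
     (\<forall>x y. (\<forall>i<n. x i = y i) \<longrightarrow> A x = A y) \<and>
     (\<forall>x. \<forall>i<n. Vector_Spaces.linear sE sF (\<lambda>u. A (x(i := u))))"

definition homogeneous_polynomial ::
  "('k::real_or_complex \<Rightarrow> 'e::ab_group_add \<Rightarrow> 'e) \<Rightarrow> ('k \<Rightarrow> 'f::ab_group_add \<Rightarrow> 'f) \<Rightarrow> nat \<Rightarrow>
     ('e \<Rightarrow> 'f) \<Rightarrow> bool" where
  "homogeneous_polynomial sE sF n P \<longleftrightarrow>
     (\<exists>A. multilinear sE sF n A \<and> (\<forall>x. P x = A (\<lambda>_. x)))"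

definition poly_space ::
  "('k::real_or_complex \<Rightarrow> 'e::real_normed_vector \<Rightarrow> 'e) \<Rightarrow> ('k \<Rightarrow> 'f::real_normed_vector \<Rightarrow> 'f) \<Rightarrow>
     nat \<Rightarrow> ('e \<Rightarrow> 'f) set" where
  "poly_space sE sF n = {P. homogeneous_polynomial sE sF n P \<and> continuous_on UNIV P}"

definition poly_norm :: "('e::real_normed_vector \<Rightarrow> 'f::real_normed_vector) \<Rightarrow> real" where
  "poly_norm P = (SUP x\<in>{x. norm x \<le> 1}. norm (P x))"

text \<open>A net in \<open>E\<close> is represented by the filter on \<open>E\<close> generated by the sets of its tails.\<close>

definition weakly_converges ::
  "('k::real_or_complex \<Rightarrow> 'e::real_normed_vector \<Rightarrow> 'e) \<Rightarrow> 'e filter \<Rightarrow> 'e \<Rightarrow> bool" where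
  "weakly_converges sE \<F> x \<longleftrightarrow> (\<forall>\<phi>\<in>dual_space sE UNIV norm. (\<phi> \<longlongrightarrow> \<phi> x) \<F>)"

definition weakly_continuous_on_bounded ::
  "('k::real_or_complex \<Rightarrow> 'e::real_normed_vector \<Rightarrow> 'e) \<Rightarrow> ('e \<Rightarrow> 'f::real_normed_vector) \<Rightarrow> bool" where
  "weakly_continuous_on_bounded sE P \<longleftrightarrow>
     (\<forall>\<F> x. (\<exists>R. \<forall>\<^sub>F y in \<F>. norm y \<le> R) \<and> weakly_converges sE \<F> x \<longrightarrow>
        ((\<lambda>y. norm (P y - P x)) \<longlongrightarrow> 0) \<F>)"

definition wpoly_space ::
  "('k::real_or_complex \<Rightarrow> 'e::real_normed_vector \<Rightarrow> 'e) \<Rightarrow> ('k \<Rightarrow> 'f::real_normed_vector \<Rightarrow> 'f) \<Rightarrow>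
     nat \<Rightarrow> ('e \<Rightarrow> 'f) set" where
  "wpoly_space sE sF n = {P \<in> poly_space sE sF n. weakly_continuous_on_bounded sE P}"

definition critical_degree ::
  "('k::real_or_complex \<Rightarrow> 'e::real_normed_vector \<Rightarrow> 'e) \<Rightarrow> enat" where
  "critical_degree sE =
     (if \<exists>k\<ge>1. wpoly_space sE (*) k \<noteq> poly_space sE (*) k
      then enat (LEAST k. k \<ge> 1 \<and> wpoly_space sE (*) k \<noteq> poly_space sE (*) k)
      else \<infinity>)"

end

theory Submission
  imports Defs
begin

text \<open>Suppose \<open>k = cd(E) < n\<close> and put \<open>m = n - k\<close>. If \<open>\<phi>\<^sup>m P\<close> were weakly continuous on bounded sets
  for every functional \<open>\<phi>\<close>, then so would be \<open>P \<in> \<P>(\<^sup>kE)\<close>; hence it suffices to place \<open>q = \<phi>\<^sup>m P\<close>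
  (times a unit vector of \<open>F\<close>) in \<open>\<P>\<^sub>w(\<^sup>nE, F)\<close>, where \<open>\<parallel>\<phi>\<parallel> \<le> 1\<close>. Otherwise \<open>q\<close> has positive distance \<open>d\<close>
  from this space, and the two-ball property of M-ideals, applied to \<open>q\<close> and \<open>d \<phi>\<^sup>n\<close>, gives a weakly
  continuous \<open>w\<close> such that \<open>R = q - w\<close> satisfies \<open>\<bar>R\<bar>\<^sup>2 + d\<^sup>2 \<bar>\<phi>\<bar>\<^sup>2\<^sup>n \<le> (d + \<epsilon>)\<^sup>2\<close> on the unit ball.
  For small \<open>t > 0\<close>, \<open>\<parallel>R + t q\<parallel> \<ge> (1 + t) d\<close>, so at some point of the ball \<open>\<bar>R\<bar>\<close> is close to \<open>d\<close> while
  \<open>\<bar>q\<bar> \<ge> d / 2\<close>. The former forces \<open>\<phi>\<close>, and therefore \<open>q\<close>, to be small at that point, a contradiction.\<close>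

section \<open>The scalar field\<close>

text \<open>An isometric embedding fixes the reals, because \<open>\<bar>z\<bar>\<close> and \<open>\<bar>z - 1\<bar>\<close> determine
  a real number \<open>z\<close> among the complex numbers.\<close>

lemma scalar_embedding:
  obtains f :: "'k::real_or_complex \<Rightarrow> complex" where
    "\<And>x y. f (x + y) = f x + f y" "\<And>x y. f (x - y) = f x - f y" "\<And>x y. f (x * y) = f x * f y"
    "\<And>x. norm (f x) = norm x" "\<And>r. f (of_real r) = of_real r" "inj f"
    "range f = \<real> \<or> range f = UNIV"
proof -
  obtain f :: "'k \<Rightarrow> complex" where add: "\<And>x y. f (x + y) = f x + f y"
    and mult: "\<And>x y. f (x * y) = f x * f y" and nrm: "\<And>x. norm (f x) = norm x"
    and rg: "range f = \<real> \<or> range f = UNIV"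
    using real_or_complex[where 'a='k] by auto
  have diff: "f (x - y) = f x - f y" for x y
    using add[of "x - y" y] by simp
  \<comment> \<open>\<open>f 1\<close> is an idempotent of a field, hence 0 or 1, and the isometry
    excludes 0.\<close>
  have "f 1 * f 1 = f 1" using mult[of 1 1] by simp
  moreover have "f 1 \<noteq> 0" using nrm[of 1] by auto
  ultimately have one: "f 1 = 1" by simp
  have inj: "inj f"
  proof (rule injI)
    fix x y assume "f x = f y"
    then have "norm (x - y) = 0" using nrm[of "x - y"] diff by simp
    then show "x = y" by simp
  qed
  have "f (of_real r) = of_real r" for r
  proof -
    define z where "z = f (of_real r)"
    have 1: "(norm z)\<^sup>2 = r\<^sup>2" using nrm[of "of_real r"] unfolding z_def by simp
    have "z - 1 = f (of_real (r - 1))" unfolding z_def by (simp add: diff one)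
    then have "norm (z - 1) = \<bar>r - 1\<bar>" using nrm[of "of_real (r - 1)"] by (metis norm_of_real)
    then have 2: "(norm (z - 1))\<^sup>2 = (r - 1)\<^sup>2" by simp
    \<comment> \<open>The difference of the two squared moduli is linear in
      \<open>Re z\<close>.\<close>
    have "Re z = r" using 1 2 unfolding cmod_power2 by (simp add: power2_eq_square algebra_simps)
    moreover have "Im z = 0" using 1 calculation by (simp add: cmod_power2)
    ultimately show ?thesis unfolding z_def by (simp add: complex_eq_iff)
  qed
  then show ?thesis using that add diff mult nrm inj rg by blast
qed

text \<open>Transported from the complex numbers along the embedding. It later turns the two
  estimates of the two-ball property into one bound for a sum of squares.\<close>

lemma parallelogram_scalar:
  fixes a b :: "'k::real_or_complex"
  shows "(norm (a + b))\<^sup>2 + (norm (a - b))\<^sup>2 = 2 * (norm a)\<^sup>2 + 2 * (norm b)\<^sup>2"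
proof -
  obtain f :: "'k \<Rightarrow> complex" where f: "\<And>x y. f (x + y) = f x + f y" "\<And>x y. f (x - y) = f x - f y"
    "\<And>x. norm (f x) = norm x"
    using scalar_embedding by metis
  have "(norm (f a + f b))\<^sup>2 + (norm (f a - f b))\<^sup>2 = 2 * (norm (f a))\<^sup>2 + 2 * (norm (f b))\<^sup>2"
    unfolding cmod_power2 by (simp add: power2_eq_square algebra_simps)
  then show ?thesis by (simp add: f flip: f(1,2))
qed

text \<open>Multiplying by such a \<open>c\<close> reduces estimates of a modulus to estimates of a
  nonnegative real value.\<close>

lemma unimodular_rotation:
  fixes z :: "'k::real_or_complex"
  obtains c where "norm c = 1" "c * z = of_real (norm z)"
proof (cases "z = 0")
  case True
  then show ?thesis using that[of 1] by simp
next
  case False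
  then show ?thesis using that[of "of_real (norm z) / z"] by (simp add: norm_divide)
qed


section \<open>The Hahn-Banach theorem\<close>

text \<open>Zorn's lemma is applied to the dominated linear extensions of the functional
  \<open>r v0 \<mapsto> r p(v0)\<close> on the line through \<open>v0\<close>. A maximal one has
  domain \<open>V\<close>, because any other domain can be enlarged by one more vector.\<close>

lemma hahn_banach_real:
  fixes s :: "real \<Rightarrow> 'v::ab_group_add \<Rightarrow> 'v" and p :: "'v \<Rightarrow> real"
  assumes "module s" and V: "module.subspace s V"
    and sub: "\<And>u v. u \<in> V \<Longrightarrow> v \<in> V \<Longrightarrow> p (u + v) \<le> p u + p v"
    and hom: "\<And>t v. t > 0 \<Longrightarrow> v \<in> V \<Longrightarrow> p (s t v) \<le> t * p v"
    and v0: "v0 \<in> V"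
  shows "\<exists>g. (\<forall>u\<in>V. \<forall>v\<in>V. g (u + v) = g u + g v) \<and> (\<forall>r. \<forall>v\<in>V. g (s r v) = r * g v) \<and>
    (\<forall>v\<in>V. g v \<le> p v) \<and> g v0 = p v0"
proof -
  interpret module s by fact
  have Va: "\<And>u v. u \<in> V \<Longrightarrow> v \<in> V \<Longrightarrow> u + v \<in> V" and Vs: "\<And>u r. u \<in> V \<Longrightarrow> s r u \<in> V" and V0: "0 \<in> V"
    using V by (auto simp: subspace_add subspace_scale subspace_0)
  \<comment> \<open>The reverse inequality is \<open>hom\<close> for the factor \<open>1/t\<close>
    at the vector \<open>s t v\<close>.\<close>
  have heq: "p (s t v) = t * p v" if "t > 0" "v \<in> V" for t v
    using hom[OF that] hom[of "1/t" "s t v"] that Vs[of v] by (auto simp: field_simps)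
  have p0: "p 0 \<ge> 0" using sub[of 0 0] V0 by simp
  \<comment> \<open>Partial functionals are represented by their graphs, ordered by inclusion.
    Single-valuedness is a consequence of the domination by \<open>p\<close>; it is derived at the
    end as \<open>uniq\<close>.\<close>
  define \<G> where "\<G> = {G. G \<subseteq> V \<times> UNIV \<and> (v0, p v0) \<in> G \<and>
     (\<forall>u a v b. (u, a) \<in> G \<longrightarrow> (v, b) \<in> G \<longrightarrow> (u + v, a + b) \<in> G) \<and>
     (\<forall>u a r. (u, a) \<in> G \<longrightarrow> (s r u, r * a) \<in> G) \<and> (\<forall>u a. (u, a) \<in> G \<longrightarrow> a \<le> p u)}"
  define G0 where "G0 = {(s r v0, r * p v0) | r. True}"
  have "r * p v0 \<le> p (s r v0)" for r
  proof -
    consider "r > 0" | "r = 0" | "r < 0" by linarith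
    then show ?thesis
    proof cases
      case 3
      \<comment> \<open>For negative \<open>r\<close> one uses
        \<open>0 \<le> p 0 \<le> p (s (- r) v0) + p (s r v0)\<close>.\<close>
      then have "p (s (- r) v0) = - r * p v0" using heq[of "-r" v0] v0 by auto
      moreover have "p (s (- r) v0 + s r v0) \<le> p (s (- r) v0) + p (s r v0)"
        using sub Vs v0 by blast
      moreover have "s (- r) v0 + s r v0 = 0" by simp
      ultimately show ?thesis using p0 by simp
    qed (use heq v0 p0 in auto)
  qed
  moreover have "(v0, p v0) \<in> G0" unfolding G0_def by (force intro: exI[of _ 1])
  moreover have "(s r v0 + s r' v0, r * p v0 + r' * p v0) \<in> G0" for r r'
    unfolding G0_def by (force simp: scale_left_distrib algebra_simps intro: exI[of _ "r + r'"])
  moreover have "(s r' (s r v0), r' * (r * p v0)) \<in> G0" for r r'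
    unfolding G0_def by (force simp: algebra_simps intro: exI[of _ "r' * r"])
  ultimately have "G0 \<in> \<G>"
    unfolding \<G>_def using v0 Vs by (auto simp: G0_def)
  then have ne: "\<G> \<noteq> {}" by blast
  have "\<Union>\<C> \<in> \<G>" if ch: "\<C> \<noteq> {}" "subset.chain \<G> \<C>" for \<C>
  proof -
    have C: "G \<in> \<G>" if "G \<in> \<C>" for G using ch that by (auto simp: subset_chain_def)
    have add: "(u + v, a + b) \<in> \<Union>\<C>" if uv: "(u, a) \<in> \<Union>\<C>" "(v, b) \<in> \<Union>\<C>" for u a v b
    proof -
      obtain G H where GH: "G \<in> \<C>" "H \<in> \<C>" "(u, a) \<in> G" "(v, b) \<in> H" using uv by blast
      then have "G \<subseteq> H \<or> H \<subseteq> G" using ch by (auto simp: subset_chain_def)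
      then obtain K where "K \<in> \<C>" "(u, a) \<in> K" "(v, b) \<in> K" using GH by blast
      then show ?thesis using C[of K] unfolding \<G>_def by blast
    qed
    show ?thesis
      unfolding \<G>_def mem_Collect_eq
    proof (intro conjI allI impI)
      show "\<Union>\<C> \<subseteq> V \<times> UNIV" using C unfolding \<G>_def by blast
      show "(v0, p v0) \<in> \<Union>\<C>" using C ch(1) unfolding \<G>_def by blast
      show "(s r u, r * a) \<in> \<Union>\<C>" if "(u, a) \<in> \<Union>\<C>" for u a r
        using that C unfolding \<G>_def by blast
      show "a \<le> p u" if "(u, a) \<in> \<Union>\<C>" for u a
        using that C unfolding \<G>_def by blast
    qed (rule add)
  qed
  from subset_Zorn_nonempty[OF ne this]
  obtain G where "G \<in> \<G>" and mx: "\<And>H. H \<in> \<G> \<Longrightarrow> G \<subseteq> H \<Longrightarrow> H = G" by blast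
  then have GV: "u \<in> V" if "(u, a) \<in> G" for u a
    using that unfolding \<G>_def by blast
  have Gv0: "(v0, p v0) \<in> G"
    and Ga: "\<And>u a v b. (u, a) \<in> G \<Longrightarrow> (v, b) \<in> G \<Longrightarrow> (u + v, a + b) \<in> G"
    and Gs: "\<And>u a r. (u, a) \<in> G \<Longrightarrow> (s r u, r * a) \<in> G" and Gp: "\<And>u a. (u, a) \<in> G \<Longrightarrow> a \<le> p u"
    using \<open>G \<in> \<G>\<close> unfolding \<G>_def by blast+
  have G0: "(0, 0) \<in> G" using Gs[OF Gv0, of 0] by simp
  have dom: "\<exists>a. (w, a) \<in> G" if w: "w \<in> V" for w
  proof -
    \<comment> \<open>An admissible value \<open>c\<close> at the new vector \<open>w\<close> must
      satisfy \<open>a - p (u - w) \<le> c \<le> p (v + w) - b\<close> for all points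
      \<open>(u, a)\<close> and \<open>(v, b)\<close> of the graph. Subadditivity makes these
      requirements compatible, and \<open>Sup L\<close> meets them.\<close>
    define L where "L = {a - p (u - w) | u a. (u, a) \<in> G}"
    have mV: "u - w \<in> V" if "u \<in> V" for u
      using V that w by (auto simp: subspace_diff)
    have le: "a - p (u - w) \<le> p (v + w) - b" if "(u, a) \<in> G" "(v, b) \<in> G" for u a v b
    proof -
      have "a + b \<le> p ((u - w) + (v + w))" using Gp[OF Ga[OF that]] by simp
      also have "\<dots> \<le> p (u - w) + p (v + w)" by (intro sub mV Va GV[OF that(1)] GV[OF that(2)] w)
      finally show ?thesis by simp
    qed
    define c where "c = Sup L"
    have "L \<noteq> {}" using G0 unfolding L_def by blast
    have "bdd_above L"
      unfolding L_def bdd_above_def using le[OF _ G0] by blast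
    have c1: "a - c \<le> p (u - w)" if "(u, a) \<in> G" for u a
    proof -
      have "a - p (u - w) \<le> c"
        unfolding c_def by (rule cSup_upper) (use that \<open>bdd_above L\<close> in \<open>auto simp: L_def\<close>)
      then show ?thesis by simp
    qed
    have c2: "b + c \<le> p (v + w)" if "(v, b) \<in> G" for v b
    proof -
      have "c \<le> p (v + w) - b"
        unfolding c_def by (rule cSup_least[OF \<open>L \<noteq> {}\<close>]) (use le[OF _ that] in \<open>auto simp: L_def\<close>)
      then show ?thesis by simp
    qed
    define H where "H = {(u + s t w, a + t * c) | u a t. (u, a) \<in> G}"
    have HI: "(u + s t w, a + t * c) \<in> H" if "(u, a) \<in> G" for u a t
      unfolding H_def using that by blast
    have "G \<subseteq> H"
    proof
      fix z assume "z \<in> G"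
      then show "z \<in> H" using HI[of "fst z" "snd z" 0] by simp
    qed
    have bd: "a + t * c \<le> p (u + s t w)" if ua: "(u, a) \<in> G" for u a t
    proof -
      \<comment> \<open>Scaling by \<open>1 / \<bar>t\<bar>\<close> reduces the domination to the
        coefficients 1 and -1 of \<open>w\<close>, which are \<open>c2\<close> and
        \<open>c1\<close>.\<close>
      consider "t > 0" | "t = 0" | "t < 0" by linarith
      then show ?thesis
      proof cases
        case 1
        then have "s t (s (1/t) u + w) = u + s t w" by (simp add: scale_right_distrib)
        then have "p (u + s t w) = t * p (s (1/t) u + w)"
          using heq[of t "s (1/t) u + w"] 1 Va[OF Vs[OF GV[OF ua]] w] by simp
        moreover have "1/t * a + c \<le> p (s (1/t) u + w)" using c2 Gs ua by blast
        then have "t * (1/t * a + c) \<le> t * p (s (1/t) u + w)" using 1 by (intro mult_left_mono) auto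
        ultimately show ?thesis using 1 by (simp add: distrib_left)
      next
        case 2
        then show ?thesis using Gp ua by simp
      next
        case 3
        define r where "r = - t"
        have r: "r > 0" "t = - r" using 3 unfolding r_def by auto
        then have "s r (s (1/r) u - w) = u + s t w" by (simp add: scale_right_diff_distrib)
        then have "p (u + s t w) = r * p (s (1/r) u - w)"
          using heq[of r "s (1/r) u - w"] r mV[OF Vs[OF GV[OF ua]]] by simp
        moreover have "1/r * a - c \<le> p (s (1/r) u - w)" using c1 Gs ua by blast
        then have "r * (1/r * a - c) \<le> r * p (s (1/r) u - w)" using r by (intro mult_left_mono) auto
        ultimately show ?thesis using r by (simp add: right_diff_distrib)
      qed
    qed
    have "H \<in> \<G>"
      unfolding \<G>_def mem_Collect_eq
    proof (intro conjI allI impI)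
      show "H \<subseteq> V \<times> UNIV" unfolding H_def using GV Va Vs w by auto
      show "(v0, p v0) \<in> H" using Gv0 \<open>G \<subseteq> H\<close> by blast
      fix u a assume "(u, a) \<in> H"
      then obtain u' a' t where u: "u = u' + s t w" "a = a' + t * c" "(u', a') \<in> G"
        unfolding H_def by blast
      show "a \<le> p u" using bd u by simp
      show "(s r u, r * a) \<in> H" for r
        using HI[OF Gs[OF u(3), of r], of "r * t"] u by (simp add: scale_right_distrib algebra_simps)
      fix v b assume "(v, b) \<in> H"
      then obtain v' b' t' where v: "v = v' + s t' w" "b = b' + t' * c" "(v', b') \<in> G"
        unfolding H_def by blast
      show "(u + v, a + b) \<in> H"
        using HI[OF Ga[OF u(3) v(3)], of "t + t'"] u v by (simp add: scale_left_distrib algebra_simps)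
    qed
    with mx \<open>G \<subseteq> H\<close> have "H = G" by blast
    then show ?thesis using HI[OF G0, of 1] by auto
  qed
  have uniq: "a = b" if "(u, a) \<in> G" "(u, b) \<in> G" for u a b
  proof -
    have z: "a = 0" if "(0, a) \<in> G" for a
    proof -
      have "r * a \<le> p 0" for r using Gp[OF Gs[OF that, of r]] by simp
      \<comment> \<open>For nonzero \<open>a\<close> this multiple would give
        \<open>p 0 + 1 \<le> p 0\<close>.\<close>
      from this[of "(p 0 + 1) / a"] show ?thesis by (cases "a = 0") auto
    qed
    show ?thesis using z[of "a - b"] Ga[OF that(1) Gs[OF that(2), of "-1"]] by simp
  qed
  define g where "g v = (SOME a. (v, a) \<in> G)" for v
  have g: "(v, g v) \<in> G" if "v \<in> V" for v
    unfolding g_def using someI_ex[OF dom[OF that]] .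
  show ?thesis
  proof (intro exI[of _ g] conjI ballI allI)
    show "g (u + v) = g u + g v" if "u \<in> V" "v \<in> V" for u v
      using uniq[OF g[OF Va[OF that]] Ga[OF g[OF that(1)] g[OF that(2)]]] .
    show "g (s r v) = r * g v" if "v \<in> V" for r v
      using uniq[OF g[OF Vs[OF that]] Gs[OF g[OF that]]] .
    show "g v \<le> p v" if "v \<in> V" for v using Gp[OF g[OF that]] .
    show "g v0 = p v0" using uniq[OF g[OF v0] Gv0] .
  qed
qed


text \<open>The real theorem, applied to \<open>V\<close> as a real space, gives the real part
  \<open>g\<close> of the functional. The functional is recovered from \<open>g\<close>, and a
  rotation extends the domination from the real part to the modulus. The value 0 outside
  \<open>V\<close> matches the convention of \<open>dual_space\<close>.\<close>

lemma hahn_banach: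
  fixes sc :: "'k::real_or_complex \<Rightarrow> 'v::ab_group_add \<Rightarrow> 'v" and p :: "'v \<Rightarrow> real"
  assumes "module sc" and V: "module.subspace sc V"
    and sub: "\<And>u v. u \<in> V \<Longrightarrow> v \<in> V \<Longrightarrow> p (u + v) \<le> p u + p v"
    and hom: "\<And>c v. v \<in> V \<Longrightarrow> p (sc c v) \<le> norm c * p v"
    and v0: "v0 \<in> V"
  shows "\<exists>\<phi>. (\<forall>u\<in>V. \<forall>v\<in>V. \<phi> (u + v) = \<phi> u + \<phi> v) \<and> (\<forall>c. \<forall>v\<in>V. \<phi> (sc c v) = c * \<phi> v) \<and>
    (\<forall>v\<in>V. norm (\<phi> v) \<le> p v) \<and> \<phi> v0 = of_real (p v0) \<and> (\<forall>v. v \<notin> V \<longrightarrow> \<phi> v = 0)"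
proof -
  interpret module sc by fact
  have Va: "\<And>u v. u \<in> V \<Longrightarrow> v \<in> V \<Longrightarrow> u + v \<in> V" and Vs: "\<And>u c. u \<in> V \<Longrightarrow> sc c u \<in> V"
    and V0: "0 \<in> V"
    using V by (auto simp: subspace_add subspace_scale subspace_0)
  define s where "s r = sc (of_real r)" for r
  have ms: "module s"
    by standard (auto simp: s_def scale_left_distrib scale_right_distrib)
  have Vss: "module.subspace s V"
    unfolding module.subspace_def[OF ms] using Va Vs V0 by (auto simp: s_def)
  have hs: "p (s t v) \<le> t * p v" if "t > 0" "v \<in> V" for t v
    using hom[OF that(2), of "of_real t"] that unfolding s_def by simp
  obtain g where ga: "\<And>u v. u \<in> V \<Longrightarrow> v \<in> V \<Longrightarrow> g (u + v) = g u + g v"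
    and gs: "\<And>r v. v \<in> V \<Longrightarrow> g (s r v) = r * g v" and gp: "\<And>v. v \<in> V \<Longrightarrow> g v \<le> p v"
    and g0: "g v0 = p v0"
    using hahn_banach_real[where p = p, OF ms Vss sub hs v0] by blast
  obtain f :: "'k \<Rightarrow> complex" where f: "\<And>x y. f (x + y) = f x + f y"
      "\<And>x y. f (x - y) = f x - f y" "\<And>x y. f (x * y) = f x * f y"
      "\<And>x. norm (f x) = norm x" and fr: "\<And>r. f (of_real r) = of_real r" and inj: "inj f"
      and rg: "range f = \<real> \<or> range f = UNIV"
    by (rule scalar_embedding) blast
  have "\<exists>\<phi>. (\<forall>u\<in>V. \<forall>v\<in>V. \<phi> (u + v) = \<phi> u + \<phi> v) \<and> (\<forall>c. \<forall>v\<in>V. \<phi> (sc c v) = c * \<phi> v) \<and>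
     (\<forall>v\<in>V. Re (f (\<phi> v)) = g v)"
    using rg
  proof
    assume R: "range f = \<real>"
    have c: "\<exists>r. c = of_real r" for c :: 'k
    proof -
      have "f c \<in> \<real>" using R by blast
      then obtain r where "f c = of_real r" by (auto simp: Reals_def)
      then have "f c = f (of_real r)" by (simp add: fr)
      then show ?thesis using inj by (auto dest: injD)
    qed
    show ?thesis
    proof (intro exI[of _ "\<lambda>v. of_real (g v)"] conjI allI ballI)
      fix c :: 'k and v assume "v \<in> V"
      obtain r where "c = of_real r" using c by blast
      then show "of_real (g (sc c v)) = c * of_real (g v)"
        using gs[OF \<open>v \<in> V\<close>, of r] by (simp add: s_def)
    qed (auto simp: ga fr)
  next
    assume R: "range f = UNIV"
    then obtain i where i: "f i = \<i>" by (metis surjD)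
    have "f (i * i) = f (of_real (- 1))" by (simp only: f fr i) simp
    then have ii: "i * i = - 1" using inj by (auto dest: injD)
    have c: "\<exists>a b. c = of_real a + i * of_real b" for c :: 'k
    proof -
      have "f c = f (of_real (Re (f c)) + i * of_real (Im (f c)))"
        using complex_eq[of "f c"] by (simp only: f fr i)
      then show ?thesis using inj by (blast dest: injD)
    qed
    \<comment> \<open>A complex linear functional with real part \<open>g\<close> has the form
      \<open>g v - i g(i v)\<close>.\<close>
    show ?thesis
    proof (intro exI[of _ "\<lambda>v. of_real (g v) - i * of_real (g (sc i v))"] conjI allI ballI)
      fix u v assume "u \<in> V" "v \<in> V"
      then show "of_real (g (u + v)) - i * of_real (g (sc i (u + v))) =
        of_real (g u) - i * of_real (g (sc i u)) + (of_real (g v) - i * of_real (g (sc i v)))"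
        by (simp add: scale_right_distrib ga Vs algebra_simps)
    next
      fix c :: 'k and v assume v: "v \<in> V"
      obtain a b where ab: "c = of_real a + i * of_real b" using c by blast
      have "sc c v = s a v + s b (sc i v)"
        by (simp add: ab s_def scale_left_distrib mult.commute)
      then have 1: "g (sc c v) = a * g v + b * g (sc i v)"
        using v Vs ga[of "s a v" "s b (sc i v)"] gs[of v a] gs[of "sc i v" b]
        by (simp add: s_def)
      have "sc i (sc c v) = s a (sc i v) + s (- b) v"
        using ii by (simp add: ab s_def scale_left_distrib algebra_simps flip: mult.assoc)
      then have 2: "g (sc i (sc c v)) = a * g (sc i v) - b * g v"
        using v Vs ga[of "s a (sc i v)" "s (- b) v"] gs[of v "- b"] gs[of "sc i v" a]
          Vs[of v "- of_real b"]
        by (simp add: s_def)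
      have iz: "i * (i * z) = - z" for z using ii by (simp flip: mult.assoc)
      show "of_real (g (sc c v)) - i * of_real (g (sc i (sc c v))) =
        c * (of_real (g v) - i * of_real (g (sc i v)))"
        unfolding 1 2 by (simp add: ab iz algebra_simps)
    next
      fix v
      show "Re (f (of_real (g v) - i * of_real (g (sc i v)))) = g v"
        by (simp add: f fr i)
    qed
  qed
  then obtain \<psi> where \<psi>: "\<And>u v. u \<in> V \<Longrightarrow> v \<in> V \<Longrightarrow> \<psi> (u + v) = \<psi> u + \<psi> v"
    "\<And>c v. v \<in> V \<Longrightarrow> \<psi> (sc c v) = c * \<psi> v" "\<And>v. v \<in> V \<Longrightarrow> Re (f (\<psi> v)) = g v"
    by blast
  have bd: "norm (\<psi> v) \<le> p v" if v: "v \<in> V" for v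
  proof -
    obtain c where c: "norm c = 1" "c * \<psi> v = of_real (norm (\<psi> v))"
      using unimodular_rotation by blast
    have "norm (\<psi> v) = Re (f (c * \<psi> v))" by (simp add: c fr)
    also have "\<dots> = g (sc c v)" using \<psi> v Vs by metis
    also have "\<dots> \<le> p (sc c v)" using gp v Vs by blast
    also have "\<dots> \<le> p v" using hom[OF v, of c] c by simp
    finally show ?thesis .
  qed
  have "\<psi> v0 = of_real (p v0)"
  proof -
    \<comment> \<open>The real part already equals the bound \<open>p v0\<close> of the modulus,
      which forces the imaginary part to vanish.\<close>
    have R: "Re (f (\<psi> v0)) = p v0" using \<psi>(3)[OF v0] g0 by simp
    have "norm (f (\<psi> v0)) \<le> p v0" using bd[OF v0] f by simp
    then have "(norm (f (\<psi> v0)))\<^sup>2 \<le> (p v0)\<^sup>2" by (intro power_mono) auto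
    then have "Im (f (\<psi> v0)) = 0" unfolding cmod_power2 R by simp
    then have "f (\<psi> v0) = f (of_real (p v0))" using R fr by (simp add: complex_eq_iff)
    then show ?thesis using inj by (auto dest: injD)
  qed
  then show ?thesis
    using \<psi> bd Va Vs v0 by (intro exI[of _ "\<lambda>v. if v \<in> V then \<psi> v else 0"]) auto
qed


lemma norming_functional:
  fixes sE :: "'k::real_or_complex \<Rightarrow> 'e::banach \<Rightarrow> 'e"
  assumes "banach_space_over sE"
  obtains \<phi> where "\<phi> \<in> dual_space sE UNIV norm" "\<And>v. norm (\<phi> v) \<le> norm v"
    "\<phi> x = of_real (norm x)"
proof -
  interpret banach_space_over sE by fact
  have sub: "norm (u + v) \<le> norm u + norm v" for u v :: 'e by (rule norm_triangle_ineq)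
  have hom: "norm (sE c v) \<le> norm c * norm v" for c v by (simp add: norm_scale)
  obtain \<phi> where \<phi>: "\<And>u v. u \<in> UNIV \<Longrightarrow> v \<in> UNIV \<Longrightarrow> \<phi> (u + v) = \<phi> u + \<phi> v"
    "\<And>c v. v \<in> UNIV \<Longrightarrow> \<phi> (sE c v) = c * \<phi> v" "\<And>v. v \<in> UNIV \<Longrightarrow> norm (\<phi> v) \<le> norm v"
    "\<phi> x = of_real (norm x)"
    using hahn_banach[of sE UNIV norm x, OF module_axioms subspace_UNIV sub hom UNIV_I] by blast
  then have "\<phi> \<in> dual_space sE UNIV norm"
    unfolding dual_space_def by (auto intro!: exI[of _ 1])
  with \<phi> show ?thesis using that by blast
qed


section \<open>The two-ball property of M-ideals\<close>

text \<open>The abstract setting in which the M-ideal property is exploited. As for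
  \<open>poly_norm\<close>, the axioms of \<open>N\<close> concern only elements of
  \<open>V\<close>.\<close>

locale seminormed_space = module sc
  for sc :: "'k::real_or_complex \<Rightarrow> 'v::ab_group_add \<Rightarrow> 'v" +
  fixes V :: "'v set" and N :: "'v \<Rightarrow> real"
  assumes subspace_V: "subspace V"
    and N_triangle: "u \<in> V \<Longrightarrow> v \<in> V \<Longrightarrow> N (u + v) \<le> N u + N v"
    and N_scale: "v \<in> V \<Longrightarrow> N (sc c v) = norm c * N v"
    and N_nonneg: "v \<in> V \<Longrightarrow> N v \<ge> 0"
begin

lemma N_zero: "N 0 = 0"
  using N_scale[of 0 0] subspace_0[OF subspace_V] by simp

text \<open>The supremum of an unbounded set has no useful value in HOL; this bound makes
  \<open>dual_norm\<close> behave as an operator norm.\<close>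

lemma dual_bdd_above:
  assumes "\<phi> \<in> dual_space sc V N"
  shows "bdd_above ((\<lambda>v. norm (\<phi> v)) ` {v \<in> V. N v \<le> 1})"
proof -
  obtain B where B: "\<And>v. v \<in> V \<Longrightarrow> norm (\<phi> v) \<le> B * N v"
    using assms unfolding dual_space_def by blast
  have "norm (\<phi> v) \<le> \<bar>B\<bar>" if "v \<in> V" "N v \<le> 1" for v
  proof -
    \<comment> \<open>\<open>B\<close> may be negative if \<open>N\<close> vanishes on
      \<open>V\<close>, hence the absolute value.\<close>
    have "norm (\<phi> v) \<le> \<bar>B\<bar> * N v"
      using B[OF that(1)] mult_right_mono[OF abs_ge_self[of B] N_nonneg[OF that(1)]] by linarith
    also have "\<dots> \<le> \<bar>B\<bar> * 1" by (intro mult_left_mono that) auto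
    finally show ?thesis by simp
  qed
  then show ?thesis by (auto simp: bdd_above_def)
qed

text \<open>By scaling to \<open>N v = 1\<close>. Vectors with \<open>N v = 0\<close> are treated
  apart: there the boundedness of \<open>\<phi>\<close> gives the value 0.\<close>

lemma dual_norm_bound:
  assumes \<phi>: "\<phi> \<in> dual_space sc V N" and v: "v \<in> V"
  shows "norm (\<phi> v) \<le> dual_norm V N \<phi> * N v"
proof (cases "N v = 0")
  case True
  then show ?thesis using assms unfolding dual_space_def by fastforce
next
  case False
  then have pos: "N v > 0" using N_nonneg[OF v] by simp
  define w where "w = sc (of_real (1 / N v)) v"
  have w: "w \<in> V" "N w \<le> 1"
    using v pos subspace_V by (auto simp: w_def N_scale subspace_scale norm_divide)
  have "norm (\<phi> w) \<le> dual_norm V N \<phi>"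
    unfolding dual_norm_def using w by (intro cSUP_upper dual_bdd_above[OF \<phi>]) auto
  moreover have "\<phi> w = of_real (1 / N v) * \<phi> v"
    unfolding w_def using \<phi> v unfolding dual_space_def by blast
  then have "norm (\<phi> w) = norm (\<phi> v) / N v"
    using pos by (simp add: norm_mult norm_divide)
  ultimately show ?thesis using pos by (simp add: field_simps)
qed

lemma dual_norm_le:
  assumes "\<And>v. v \<in> V \<Longrightarrow> N v \<le> 1 \<Longrightarrow> norm (\<phi> v) \<le> M"
  shows "dual_norm V N \<phi> \<le> M"
proof -
  have "0 \<in> {v \<in> V. N v \<le> 1}" using subspace_0[OF subspace_V] N_zero by simp
  then show ?thesis
    unfolding dual_norm_def using assms by (intro cSUP_least) auto
qed

text \<open>In the dual of \<open>V \<times> V\<close> (maximum norm), a functional \<open>(f\<^sub>1, f\<^sub>2)\<close> that vanishes on the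
  diagonal of \<open>J\<close> has \<open>\<pi> f\<^sub>1 = - \<pi> f\<^sub>2\<close>. Hence its value at \<open>(q + j, q - j)\<close> only sees \<open>q\<close>
  through \<open>f\<^sub>i - \<pi> f\<^sub>i\<close> and \<open>j\<close> through \<open>\<pi> f\<^sub>i\<close>, and the norm decomposition bounds it by \<open>d\<close>.\<close>

lemma M_ideal_two_ball:
  assumes M: "M_ideal sc V N J"
    and q: "q \<in> V" and j: "j \<in> J" "N j \<le> d"
    and near: "\<And>\<delta>. \<delta> > 0 \<Longrightarrow> \<exists>w\<in>J. N (q - w) \<le> d + \<delta>"
    and "\<epsilon> > 0"
  obtains w where "w \<in> J" "N (q + j - w) \<le> d + \<epsilon>" "N (q - j - w) \<le> d + \<epsilon>"
proof -
  obtain \<pi> where J: "J \<subseteq> V" "subspace J" and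
    \<pi>: "linear_projection_on_dual sc V N \<pi>" and
    ker: "{\<phi> \<in> dual_space sc V N. \<pi> \<phi> = 0} = annihilator sc V N J" and
    split: "\<And>\<phi>. \<phi> \<in> dual_space sc V N \<Longrightarrow>
       dual_norm V N \<phi> = dual_norm V N (\<pi> \<phi>) + dual_norm V N (\<phi> - \<pi> \<phi>)"
    using M unfolding M_ideal_def closed_subspace_def by blast
  define X where "X = dual_space sc V N"
  have \<pi>X: "\<And>\<phi>. \<phi> \<in> X \<Longrightarrow> \<pi> \<phi> \<in> X" and
    \<pi>a: "\<And>\<phi> \<psi>. \<phi> \<in> X \<Longrightarrow> \<psi> \<in> X \<Longrightarrow> \<pi> (\<phi> + \<psi>) = \<pi> \<phi> + \<pi> \<psi>" and
    \<pi>s: "\<And>c \<phi>. \<phi> \<in> X \<Longrightarrow> \<pi> (\<lambda>v. c * \<phi> v) = (\<lambda>v. c * \<pi> \<phi> v)" and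
    \<pi>\<pi>: "\<And>\<phi>. \<phi> \<in> X \<Longrightarrow> \<pi> (\<pi> \<phi>) = \<pi> \<phi>"
    using \<pi> unfolding linear_projection_on_dual_def X_def by blast+
  have Va: "\<And>u v. u \<in> V \<Longrightarrow> v \<in> V \<Longrightarrow> u + v \<in> V" and Vd: "\<And>u v. u \<in> V \<Longrightarrow> v \<in> V \<Longrightarrow> u - v \<in> V"
    and Vs: "\<And>u c. u \<in> V \<Longrightarrow> sc c u \<in> V" and V0: "0 \<in> V"
    using subspace_V by (auto simp: subspace_add subspace_scale subspace_0 subspace_diff)
  have Ja: "\<And>u v. u \<in> J \<Longrightarrow> v \<in> J \<Longrightarrow> u + v \<in> J" and Js: "\<And>u c. u \<in> J \<Longrightarrow> sc c u \<in> J" and J0: "0 \<in> J"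
    using J(2) by (auto simp: subspace_add subspace_scale subspace_0)
  have JV: "\<And>w. w \<in> J \<Longrightarrow> w \<in> V" using J by blast
  define sp where "sp c z = (sc c (fst z), sc c (snd z))" for c and z :: "'v \<times> 'v"
  have msp: "module sp"
    by standard (auto simp: sp_def scale_left_distrib scale_right_distrib)
  have ssp: "module.subspace sp (V \<times> V)"
    unfolding module.subspace_def[OF msp] by (auto simp: sp_def Va Vs V0 zero_prod_def)
  \<comment> \<open>\<open>p z\<close> is the distance of \<open>z\<close> from the diagonal of
    \<open>J\<close> in the maximum norm of \<open>V \<times> V\<close>, so it suffices to show
    \<open>p (q + j, q - j) < d + \<epsilon>\<close>.\<close>
  define m where "m z w = max (N (fst z - w)) (N (snd z - w))" for z w
  define p where "p z = (INF w\<in>J. m z w)" for z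
  have m0: "m z w \<ge> 0" if "z \<in> V \<times> V" "w \<in> J" for z w
    using that JV N_nonneg Vd unfolding m_def by (auto simp: le_max_iff_disj)
  have pb: "bdd_below (m z ` J)" if "z \<in> V \<times> V" for z
    using m0[OF that] by (auto simp: bdd_below_def)
  have pm: "p z \<le> m z w" if "z \<in> V \<times> V" "w \<in> J" for z w
    unfolding p_def using that by (intro cINF_lower pb) auto
  have ge: "a \<le> p z" if "\<And>w. w \<in> J \<Longrightarrow> a \<le> m z w" for a z
    unfolding p_def using that J0 by (intro cINF_greatest) auto
  have psub: "p (y + z) \<le> p y + p z" if yz: "y \<in> V \<times> V" "z \<in> V \<times> V" for y z
  proof -
    have "p (y + z) - p y \<le> m z w" if w: "w \<in> J" for w
    proof -
      have "p (y + z) - m z w \<le> m y w'" if w': "w' \<in> J" for w'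
      proof -
        have "N (fst (y + z) - (w' + w)) \<le> N (fst y - w') + N (fst z - w)"
          using N_triangle[of "fst y - w'" "fst z - w"] yz JV[OF w] JV[OF w'] Vd
          by (auto simp: algebra_simps)
        moreover have "N (snd (y + z) - (w' + w)) \<le> N (snd y - w') + N (snd z - w)"
          using N_triangle[of "snd y - w'" "snd z - w"] yz JV[OF w] JV[OF w'] Vd
          by (auto simp: algebra_simps)
        ultimately have "m (y + z) (w' + w) \<le> m y w' + m z w" unfolding m_def by linarith
        moreover have "y + z \<in> V \<times> V" using yz Va by auto
        ultimately show ?thesis using pm[of "y + z" "w' + w"] Ja w w' by force
      qed
      from ge[OF this] show ?thesis by simp
    qed
    from ge[OF this] show ?thesis by simp
  qed
  have phom: "p (sp c z) \<le> norm c * p z" if z: "z \<in> V \<times> V" for c z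
  proof -
    have sz: "sp c z \<in> V \<times> V" using z Vs by (auto simp: sp_def)
    have *: "p (sp c z) \<le> norm c * m z w" if w: "w \<in> J" for w
    proof -
      have "N (sc c (fst z) - sc c w) = norm c * N (fst z - w)"
        using N_scale[of "fst z - w" c] z JV[OF w] Vd by (auto simp: scale_right_diff_distrib)
      moreover have "N (sc c (snd z) - sc c w) = norm c * N (snd z - w)"
        using N_scale[of "snd z - w" c] z JV[OF w] Vd by (auto simp: scale_right_diff_distrib)
      ultimately have "m (sp c z) (sc c w) = norm c * m z w"
        unfolding m_def sp_def by (simp add: max_mult_distrib_left)
      then show ?thesis using pm[OF sz Js[OF w, of c]] by simp
    qed
    show ?thesis
    proof (cases "c = 0")
      case True
      then show ?thesis using *[OF J0] by simp
    next
      case False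
      have "p (sp c z) / norm c \<le> p z"
        by (rule ge) (use * False in \<open>auto simp: field_simps\<close>)
      then show ?thesis using False by (simp add: field_simps)
    qed
  qed
  have jV: "j \<in> V" using j JV by blast
  define z0 where "z0 = (q + j, q - j)"
  have z0: "z0 \<in> V \<times> V" unfolding z0_def using q jV Va Vd by auto
  \<comment> \<open>\<open>\<Phi>\<close> attains the distance at \<open>z0\<close>, has norm at
    most 1, and vanishes on the diagonal of \<open>J\<close> because \<open>p\<close> does.\<close>
  obtain \<Phi> where \<Phi>a: "\<And>y z. y \<in> V \<times> V \<Longrightarrow> z \<in> V \<times> V \<Longrightarrow> \<Phi> (y + z) = \<Phi> y + \<Phi> z"
    and \<Phi>s: "\<And>c z. z \<in> V \<times> V \<Longrightarrow> \<Phi> (sp c z) = c * \<Phi> z"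
    and \<Phi>p: "\<And>z. z \<in> V \<times> V \<Longrightarrow> norm (\<Phi> z) \<le> p z"
    and \<Phi>0: "\<Phi> z0 = of_real (p z0)" and \<Phi>n: "\<And>z. z \<notin> V \<times> V \<Longrightarrow> \<Phi> z = 0"
    using hahn_banach[where p = p, OF msp ssp psub phom z0] by blast
  have \<Phi>N: "norm (\<Phi> (u, v)) \<le> max (N u) (N v)" if "u \<in> V" "v \<in> V" for u v
    using \<Phi>p[of "(u, v)"] pm[of "(u, v)" 0] that J0 unfolding m_def by simp
  define f1 where "f1 u = \<Phi> (u, 0)" for u
  define f2 where "f2 u = \<Phi> (0, u)" for u
  have f1X: "f1 \<in> X"
    unfolding X_def dual_space_def mem_Collect_eq
  proof (intro conjI ballI allI impI exI)
    fix u v c assume "u \<in> V" "v \<in> V"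
    then show "f1 (u + v) = f1 u + f1 v" using \<Phi>a[of "(u, 0)" "(v, 0)"] V0 by (simp add: f1_def)
  next
    fix v c assume "v \<in> V"
    then show "f1 (sc c v) = c * f1 v" using \<Phi>s[of "(v, 0)" c] V0 by (simp add: f1_def sp_def)
  next
    fix v assume "v \<in> V"
    then show "norm (f1 v) \<le> 1 * N v"
      using \<Phi>N[of v 0] V0 N_zero N_nonneg[of v] by (simp add: f1_def)
  qed (simp add: f1_def \<Phi>n)
  have f2X: "f2 \<in> X"
    unfolding X_def dual_space_def mem_Collect_eq
  proof (intro conjI ballI allI impI exI)
    fix u v c assume "u \<in> V" "v \<in> V"
    then show "f2 (u + v) = f2 u + f2 v" using \<Phi>a[of "(0, u)" "(0, v)"] V0 by (simp add: f2_def)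
  next
    fix v c assume "v \<in> V"
    then show "f2 (sc c v) = c * f2 v" using \<Phi>s[of "(0, v)" c] V0 by (simp add: f2_def sp_def)
  next
    fix v assume "v \<in> V"
    then show "norm (f2 v) \<le> 1 * N v"
      using \<Phi>N[of 0 v] V0 N_zero N_nonneg[of v] by (simp add: f2_def)
  qed (simp add: f2_def \<Phi>n)
  have \<Phi>f: "\<Phi> (u, v) = f1 u + f2 v" if "u \<in> V" "v \<in> V" for u v
    using \<Phi>a[of "(u, 0)" "(0, v)"] that V0 by (simp add: f1_def f2_def)
  have Xa: "\<phi> (u + v) = \<phi> u + \<phi> v" and Xs: "\<phi> (sc c v) = c * \<phi> v"
    if "\<phi> \<in> X" "u \<in> V" "v \<in> V" for \<phi> c u v
    using that unfolding X_def dual_space_def by blast+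
  have Xm: "\<phi> (u - v) = \<phi> u - \<phi> v" if "\<phi> \<in> X" "u \<in> V" "v \<in> V" for \<phi> u v
    using Xa[OF that(1) Vd[OF that(2,3)] that(3)] by simp
  have Xadd: "\<phi> + \<psi> \<in> X" if \<phi>\<psi>: "\<phi> \<in> X" "\<psi> \<in> X" for \<phi> \<psi>
  proof -
    obtain B where B: "\<And>v. v \<in> V \<Longrightarrow> norm (\<phi> v) \<le> B * N v"
      using \<phi>\<psi>(1) unfolding X_def dual_space_def by blast
    obtain C where C: "\<And>v. v \<in> V \<Longrightarrow> norm (\<psi> v) \<le> C * N v"
      using \<phi>\<psi>(2) unfolding X_def dual_space_def by blast
    have "norm (\<phi> v + \<psi> v) \<le> (B + C) * N v" if "v \<in> V" for v
      using norm_triangle_ineq[of "\<phi> v" "\<psi> v"] B[OF that] C[OF that] by (simp add: distrib_right)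
    moreover have "\<And>v. v \<notin> V \<Longrightarrow> \<phi> v + \<psi> v = 0"
      using \<phi>\<psi> unfolding X_def dual_space_def by simp
    ultimately show ?thesis
      using Xa[OF \<phi>\<psi>(1)] Xa[OF \<phi>\<psi>(2)] Xs[OF \<phi>\<psi>(1)] Xs[OF \<phi>\<psi>(2)] unfolding X_def dual_space_def
      by (auto simp: algebra_simps intro!: exI[of _ "B + C"])
  qed
  have Xneg: "(\<lambda>v. - 1 * \<phi> v) \<in> X" if "\<phi> \<in> X" for \<phi>
    using that unfolding X_def dual_space_def by (auto simp: algebra_simps)
  \<comment> \<open>Idempotence puts \<open>\<phi> - \<pi> \<phi>\<close> into the kernel of
    \<open>\<pi>\<close>, which is the annihilator of \<open>J\<close>.\<close>
  have mpi: "\<phi> - \<pi> \<phi> \<in> X" "\<And>w. w \<in> J \<Longrightarrow> (\<phi> - \<pi> \<phi>) w = 0" if \<phi>: "\<phi> \<in> X" for \<phi>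
  proof -
    have eq: "\<phi> - \<pi> \<phi> = \<phi> + (\<lambda>v. - 1 * \<pi> \<phi> v)" by (simp add: fun_eq_iff)
    show X: "\<phi> - \<pi> \<phi> \<in> X" unfolding eq by (intro Xadd Xneg \<pi>X \<phi>)
    have "\<pi> (\<phi> - \<pi> \<phi>) = \<pi> \<phi> + (\<lambda>v. - 1 * \<pi> (\<pi> \<phi>) v)"
      unfolding eq using \<pi>a[OF \<phi> Xneg[OF \<pi>X[OF \<phi>]]] \<pi>s[OF \<pi>X[OF \<phi>], of "-1"] by simp
    also have "\<dots> = 0" by (simp add: \<pi>\<pi>[OF \<phi>] fun_eq_iff)
    finally have "\<phi> - \<pi> \<phi> \<in> annihilator sc V N J" using ker X unfolding X_def by blast
    then show "\<And>w. w \<in> J \<Longrightarrow> (\<phi> - \<pi> \<phi>) w = 0" unfolding annihilator_def by blast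
  qed
  have "f1 + f2 \<in> annihilator sc V N J"
  proof -
    have "f1 w + f2 w = 0" if w: "w \<in> J" for w
    proof -
      have "norm (\<Phi> (w, w)) \<le> m (w, w) w"
        using \<Phi>p[of "(w, w)"] pm[of "(w, w)" w] JV[OF w] w by simp
      then show ?thesis using \<Phi>f JV[OF w] by (simp add: m_def N_zero)
    qed
    then show ?thesis using Xadd[OF f1X f2X] unfolding annihilator_def X_def by simp
  qed
  then have "\<pi> (f1 + f2) = 0" using ker by blast
  then have \<pi>0: "\<pi> f2 v = - \<pi> f1 v" for v
    using fun_cong[OF \<pi>a[OF f1X f2X], of v] by (simp add: add_eq_0_iff)
  \<comment> \<open>The dual of a maximum norm is a sum norm: two rotations make both summands real
    and nonnegative, so that they add up in a single value of \<open>\<Phi>\<close>.\<close>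
  have sum: "dual_norm V N f1 + dual_norm V N f2 \<le> 1"
  proof -
    have *: "norm (f1 u) + norm (f2 v) \<le> 1" if uv: "u \<in> V" "N u \<le> 1" "v \<in> V" "N v \<le> 1" for u v
    proof -
      obtain a where a: "norm a = 1" "a * f1 u = of_real (norm (f1 u))"
        using unimodular_rotation by blast
      obtain b where b: "norm b = 1" "b * f2 v = of_real (norm (f2 v))"
        using unimodular_rotation by blast
      have "\<Phi> (sc a u, sc b v) = of_real (norm (f1 u) + norm (f2 v))"
        using \<Phi>f Vs uv Xs[OF f1X _ uv(1)] Xs[OF f2X _ uv(3)] a b V0 by simp
      then have "norm (f1 u) + norm (f2 v) = norm (\<Phi> (sc a u, sc b v))"
        by (simp only: norm_of_real) simp
      also have "\<dots> \<le> max (N (sc a u)) (N (sc b v))" using \<Phi>N Vs uv by blast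
      also have "\<dots> \<le> 1" using N_scale uv a b by simp
      finally show ?thesis .
    qed
    have "dual_norm V N f1 \<le> 1 - norm (f2 v)" if "v \<in> V" "N v \<le> 1" for v
      by (rule dual_norm_le) (use * that in force)
    then have "dual_norm V N f2 \<le> 1 - dual_norm V N f1"
      by (intro dual_norm_le) force
    then show ?thesis by simp
  qed
  \<comment> \<open>A functional that vanishes on \<open>J\<close> sees \<open>q\<close> only modulo
    \<open>J\<close>, and \<open>q\<close> has representatives modulo \<open>J\<close> of norm at
    most \<open>d + \<delta>\<close>.\<close>
  have dst: "norm (\<psi> q) \<le> dual_norm V N \<psi> * d"
    if \<psi>: "\<psi> \<in> X" "\<And>w. w \<in> J \<Longrightarrow> \<psi> w = 0" and nn: "dual_norm V N \<psi> \<ge> 0" for \<psi>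
  proof (rule field_le_epsilon)
    fix e :: real assume "e > 0"
    \<comment> \<open>The summand 1 keeps the denominator positive when the dual norm is 0.\<close>
    define \<delta> where "\<delta> = e / (dual_norm V N \<psi> + 1)"
    have "\<delta> > 0" unfolding \<delta>_def using \<open>e > 0\<close> nn by simp
    then obtain w where w: "w \<in> J" "N (q - w) \<le> d + \<delta>" using near by blast
    have "norm (\<psi> q) = norm (\<psi> (q - w))" using Xm[OF \<psi>(1) q JV] \<psi>(2) w by simp
    also have "\<dots> \<le> dual_norm V N \<psi> * N (q - w)"
      using dual_norm_bound \<psi>(1) Vd[OF q JV[OF w(1)]] unfolding X_def by blast
    also have "\<dots> \<le> dual_norm V N \<psi> * (d + \<delta>)" by (intro mult_left_mono w nn)
    also have "\<dots> = dual_norm V N \<psi> * d + dual_norm V N \<psi> * \<delta>" by (simp add: distrib_left)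
    also have "dual_norm V N \<psi> * \<delta> \<le> e" unfolding \<delta>_def using \<open>e > 0\<close> nn by (simp add: field_simps)
    finally show "norm (\<psi> q) \<le> dual_norm V N \<psi> * d + e" by simp
  qed
  have nn: "dual_norm V N \<psi> \<ge> 0" if "\<psi> \<in> X" for \<psi>
  proof -
    have "norm (\<psi> 0) \<le> dual_norm V N \<psi>" unfolding dual_norm_def
      using that V0 N_zero by (intro cSUP_upper dual_bdd_above) (auto simp: X_def)
    then show ?thesis using norm_ge_zero order_trans by blast
  qed
  have d0: "d \<ge> 0" using j N_nonneg[OF jV] by simp
  have "\<Phi> z0 = f1 (q + j) + f2 (q - j)" unfolding z0_def by (rule \<Phi>f[OF Va[OF q jV] Vd[OF q jV]])
  also have "\<dots> = (f1 q + f2 q) + (f1 j - f2 j)"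
    using Xa[OF f1X q jV] Xm[OF f2X q jV] by simp
  also have "f1 q + f2 q = (f1 - \<pi> f1) q + (f2 - \<pi> f2) q" by (simp add: \<pi>0)
  also have "f1 j - f2 j = \<pi> f1 j - \<pi> f2 j"
    using mpi(2)[OF f1X j(1)] mpi(2)[OF f2X j(1)] by simp
  finally have "norm (\<Phi> z0) = norm ((f1 - \<pi> f1) q + (f2 - \<pi> f2) q + (\<pi> f1 j - \<pi> f2 j))" by simp
  also have "\<dots> \<le> norm ((f1 - \<pi> f1) q) + norm ((f2 - \<pi> f2) q) + (norm (\<pi> f1 j) + norm (\<pi> f2 j))"
    by (intro norm_triangle_le add_mono norm_triangle_ineq norm_triangle_ineq4)
  also have "\<dots> \<le> dual_norm V N (f1 - \<pi> f1) * d + dual_norm V N (f2 - \<pi> f2) * d +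
      (dual_norm V N (\<pi> f1) * d + dual_norm V N (\<pi> f2) * d)"
  proof (intro add_mono dst mpi nn f1X f2X)
    have *: "norm (\<psi> j) \<le> dual_norm V N \<psi> * d" if "\<psi> \<in> X" for \<psi>
      using dual_norm_bound[OF that[unfolded X_def] jV] mult_left_mono[OF j(2) nn[OF that]] by linarith
    show "norm (\<pi> f1 j) \<le> dual_norm V N (\<pi> f1) * d" "norm (\<pi> f2 j) \<le> dual_norm V N (\<pi> f2) * d"
      using * \<pi>X f1X f2X by blast+
  qed
  also have "\<dots> = (dual_norm V N f1 + dual_norm V N f2) * d"
    using split[of f1] split[of f2] f1X f2X unfolding X_def by (simp add: algebra_simps)
  also have "\<dots> \<le> 1 * d" by (intro mult_right_mono sum d0)
  finally have "p z0 < d + \<epsilon>" using \<Phi>0 \<open>\<epsilon> > 0\<close> by simp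
  then obtain w where "w \<in> J" "m z0 w < d + \<epsilon>"
    unfolding p_def using pb[OF z0] J0 by (subst (asm) cINF_less_iff) auto
  then show ?thesis using that[of w] unfolding m_def z0_def by simp
qed

end


section \<open>Homogeneous polynomials\<close>

text \<open>The scalars serve as a target space too, and \<open>'k\<close> belongs to the class
  \<open>real_normed_field\<close>, not to \<open>banach\<close>. Hence this variant of
  \<open>banach_space_over\<close> for normed spaces.\<close>

locale normed_space_over = vector_space scale
  for scale :: "'k::real_or_complex \<Rightarrow> 'e::real_normed_vector \<Rightarrow> 'e" +
  assumes scale_of_real: "scale (of_real r) x = r *\<^sub>R x"
    and norm_scale: "norm (scale c x) = norm c * norm x"
begin

lemma bounded_linear_scale: "bounded_linear (scale c)"
proof (rule bounded_linear_intro[of _ "norm c"])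
  fix r :: real and x
  show "scale c (r *\<^sub>R x) = r *\<^sub>R scale c x" by (simp only: scale_of_real[symmetric] scale_scale mult.commute)
qed (auto simp: scale_right_distrib norm_scale mult.commute)

lemma bounded_linear_scale_left: "bounded_linear (\<lambda>c. scale c x)"
proof (rule bounded_linear_intro[of _ "norm x"])
  fix r :: real and c
  show "scale (r *\<^sub>R c) x = r *\<^sub>R scale c x" by (simp only: scale_of_real[symmetric] scale_scale scaleR_conv_of_real)
qed (auto simp: scale_left_distrib norm_scale)

lemma dual_space_linear:
  assumes "\<phi> \<in> dual_space scale UNIV norm"
  shows "Vector_Spaces.linear scale (*) \<phi>"
  using assms unfolding dual_space_def Vector_Spaces.linear_iff
  by (auto intro: vector_space_axioms simp: vector_space_def algebra_simps)

lemma dual_space_bounded_linear: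
  assumes "\<phi> \<in> dual_space scale UNIV norm"
  shows "bounded_linear \<phi>"
proof -
  obtain B where B: "\<And>x. norm (\<phi> x) \<le> B * norm x"
    using assms unfolding dual_space_def by blast
  have add: "\<phi> (x + y) = \<phi> x + \<phi> y" and hom: "\<phi> (scale c x) = c * \<phi> x" for x y c
    using assms unfolding dual_space_def by blast+
  show ?thesis
  proof (rule bounded_linear_intro[OF add])
    show "\<phi> (r *\<^sub>R x) = r *\<^sub>R \<phi> x" for r x
      using hom[of "of_real r" x] by (simp add: scale_of_real scaleR_conv_of_real)
    show "norm (\<phi> x) \<le> norm x * B" for x using B by (simp add: mult.commute)
  qed
qed

end

lemma normed_space_over_scalars: "normed_space_over ((*) :: 'k::real_or_complex \<Rightarrow> 'k \<Rightarrow> 'k)"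
  by unfold_locales (auto simp: algebra_simps norm_mult scaleR_conv_of_real)

lemma (in banach_space_over) normed_space_over: "normed_space_over scale"
  by unfold_locales (auto simp: scale_of_real norm_scale)

locale poly_pair = E: normed_space_over sE + F: normed_space_over sF
  for sE :: "'k::real_or_complex \<Rightarrow> 'e::real_normed_vector \<Rightarrow> 'e"
    and sF :: "'k \<Rightarrow> 'f::real_normed_vector \<Rightarrow> 'f"
begin

lemma multilinear_iff:
  "multilinear sE sF n A \<longleftrightarrow>
     (\<forall>x y. (\<forall>i<n. x i = y i) \<longrightarrow> A x = A y) \<and>
     (\<forall>x. \<forall>i<n. (\<forall>u v. A (x(i := u + v)) = A (x(i := u)) + A (x(i := v))) \<and>
       (\<forall>c u. A (x(i := sE c u)) = sF c (A (x(i := u)))))"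
  unfolding multilinear_def Vector_Spaces.linear_iff
  using E.vector_space_axioms F.vector_space_axioms by blast

lemma homogeneous_polynomial_add:
  assumes "homogeneous_polynomial sE sF n P" "homogeneous_polynomial sE sF n Q"
  shows "homogeneous_polynomial sE sF n (\<lambda>x. P x + Q x)"
proof -
  obtain A B where A: "multilinear sE sF n A" "\<And>x. P x = A (\<lambda>_. x)"
    and B: "multilinear sE sF n B" "\<And>x. Q x = B (\<lambda>_. x)"
    using assms unfolding homogeneous_polynomial_def by auto
  have "multilinear sE sF n (\<lambda>x. A x + B x)"
    using A(1) B(1) unfolding multilinear_iff
    by (simp add: F.scale_right_distrib) (metis (no_types, lifting))
  then show ?thesis unfolding homogeneous_polynomial_def using A B by auto
qed

lemma homogeneous_polynomial_compose:
  fixes sG :: "'k \<Rightarrow> 'g::real_normed_vector \<Rightarrow> 'g"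
  assumes "homogeneous_polynomial sE sF n P" and T: "Vector_Spaces.linear sF sG T"
  shows "homogeneous_polynomial sE sG n (\<lambda>x. T (P x))"
proof -
  obtain A where A: "multilinear sE sF n A" "\<And>x. P x = A (\<lambda>_. x)"
    using assms unfolding homogeneous_polynomial_def by auto
  have 1: "Vector_Spaces.linear sE sG (\<lambda>u. T (A (x(i := u))))" if "i < n" for x i
  proof -
    have "Vector_Spaces.linear sE sF (\<lambda>u. A (x(i := u)))"
      using A(1) that unfolding multilinear_def by blast
    from Vector_Spaces.linear_compose[OF this T] show ?thesis by (simp add: o_def)
  qed
  have "multilinear sE sG n (\<lambda>x. T (A x))"
    unfolding multilinear_def using 1 A(1) unfolding multilinear_def by metis
  then show ?thesis unfolding homogeneous_polynomial_def using A by auto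
qed

text \<open>Multilinearity is applied to one argument at a time: after \<open>m\<close> steps the
  first \<open>m\<close> entries carry the factor \<open>c\<close>.\<close>

lemma homogeneous_polynomial_scale_arg:
  assumes "homogeneous_polynomial sE sF n P"
  shows "P (sE c x) = sF (c ^ n) (P x)"
proof -
  obtain A where A: "multilinear sE sF n A" "\<And>x. P x = A (\<lambda>_. x)"
    using assms unfolding homogeneous_polynomial_def by auto
  have "A (\<lambda>i. if i < m then sE c x else x) = sF (c ^ m) (A (\<lambda>_. x))" if "m \<le> n" for m
    using that
  proof (induction m)
    case (Suc m)
    define z where "z = (\<lambda>i. if i < m then sE c x else x)"
    have "(\<lambda>i. if i < Suc m then sE c x else x) = z(m := sE c x)" by (auto simp: z_def fun_eq_iff)
    moreover have "A (z(m := sE c x)) = sF c (A (z(m := x)))"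
      using A(1) Suc.prems unfolding multilinear_iff by auto
    moreover have "z(m := x) = z" by (auto simp: z_def fun_eq_iff)
    ultimately show ?case using Suc by (simp add: z_def)
  qed simp
  from this[of n] have "A (\<lambda>i. if i < n then sE c x else x) = sF (c ^ n) (A (\<lambda>_. x))" by simp
  moreover have "A (\<lambda>i. if i < n then sE c x else x) = A (\<lambda>_. sE c x)"
    using A(1) unfolding multilinear_def by auto
  ultimately show ?thesis using A by simp
qed

text \<open>Continuity at 0 bounds \<open>P\<close> on a small ball, and homogeneity transports the
  bound to the unit ball. Hence the supremum in \<open>poly_norm\<close> is a genuine one.\<close>

lemma poly_space_bdd_above:
  assumes P: "P \<in> poly_space sE sF n"
  shows "bdd_above ((\<lambda>x. norm (P x)) ` {x. norm x \<le> 1})"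
proof -
  have "isCont P 0" using P unfolding poly_space_def by (auto simp: continuous_on_eq_continuous_at)
  then obtain \<delta> where \<delta>: "\<delta> > 0" "\<And>x. norm x < \<delta> \<Longrightarrow> norm (P x - P 0) < 1"
    unfolding continuous_at_eps_delta by (auto simp: dist_norm dest: spec[of _ 1])
  have "norm (P x) \<le> (2 / \<delta>) ^ n * (1 + norm (P 0))" if x: "norm x \<le> 1" for x
  proof -
    \<comment> \<open>Half of \<open>\<delta>\<close> keeps \<open>sE c x\<close> strictly inside
      the ball of radius \<open>\<delta>\<close>.\<close>
    define c :: 'k where "c = of_real (\<delta> / 2)"
    have c: "norm c = \<delta> / 2" "c \<noteq> 0" using \<delta>(1) by (auto simp: c_def norm_divide)
    have "norm (sE c x) \<le> \<delta> / 2 * 1"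
      unfolding E.norm_scale c using \<delta>(1) x by (intro mult_left_mono) auto
    then have "norm (P (sE c x) - P 0) < 1" using \<delta> by auto
    then have b: "norm (P (sE c x)) \<le> 1 + norm (P 0)" using norm_triangle_sub[of "P (sE c x)" "P 0"] by simp
    have "norm (P (sE c x)) = (\<delta> / 2) ^ n * norm (P x)"
      using homogeneous_polynomial_scale_arg[of n P c x] P
      by (simp add: poly_space_def F.norm_scale norm_power c(1))
    then have "norm (P x) = (2 / \<delta>) ^ n * norm (P (sE c x))" using \<delta>(1) by (simp add: field_simps)
    also have "\<dots> \<le> (2 / \<delta>) ^ n * (1 + norm (P 0))" using b \<delta>(1) by (intro mult_left_mono) auto
    finally show ?thesis .
  qed
  then show ?thesis by (auto simp: bdd_above_def)
qed

lemma norm_le_poly_norm: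
  assumes "P \<in> poly_space sE sF n" "norm x \<le> 1"
  shows "norm (P x) \<le> poly_norm P"
  unfolding poly_norm_def using assms by (intro cSUP_upper poly_space_bdd_above) auto

end

lemma poly_norm_le:
  fixes P :: "'e::real_normed_vector \<Rightarrow> 'f::real_normed_vector"
  assumes "\<And>x. norm x \<le> 1 \<Longrightarrow> norm (P x) \<le> M"
  shows "poly_norm P \<le> M"
proof -
  have "(0::'e) \<in> {x. norm x \<le> 1}" by simp
  then have "{x::'e. norm x \<le> 1} \<noteq> {}" by blast
  then show ?thesis unfolding poly_norm_def using assms by (intro cSUP_least) auto
qed

context poly_pair
begin

lemma poly_space_add:
  "P \<in> poly_space sE sF n \<Longrightarrow> Q \<in> poly_space sE sF n \<Longrightarrow> (\<lambda>x. P x + Q x) \<in> poly_space sE sF n"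
  by (auto simp: poly_space_def homogeneous_polynomial_add intro: continuous_on_add)

lemma poly_space_compose:
  fixes sG :: "'k \<Rightarrow> 'g::real_normed_vector \<Rightarrow> 'g"
  assumes "P \<in> poly_space sE sF n" "Vector_Spaces.linear sF sG T" "bounded_linear T"
  shows "(\<lambda>x. T (P x)) \<in> poly_space sE sG n"
  using assms bounded_linear.continuous_on[OF assms(3), of UNIV P]
  by (auto simp: poly_space_def homogeneous_polynomial_compose)

lemma poly_space_scale: "P \<in> poly_space sE sF n \<Longrightarrow> (\<lambda>x. sF c (P x)) \<in> poly_space sE sF n"
  by (rule poly_space_compose) (auto intro: F.bounded_linear_scale F.linear_scale_self)

lemma poly_space_zero: "(\<lambda>_. 0) \<in> poly_space sE sF n"
proof -
  have "multilinear sE sF n (\<lambda>_. 0)" unfolding multilinear_iff by simp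
  then show ?thesis unfolding poly_space_def homogeneous_polynomial_def by auto
qed

lemma poly_space_diff:
  assumes "P \<in> poly_space sE sF n" "Q \<in> poly_space sE sF n"
  shows "(\<lambda>x. P x - Q x) \<in> poly_space sE sF n"
  using poly_space_add[OF assms(1) poly_space_scale[OF assms(2), of "-1"]] by simp

lemma seminormed_space_poly: "seminormed_space (\<lambda>c P x. sF c (P x)) (poly_space sE sF n) poly_norm"
proof -
  have m: "module (\<lambda>c (P :: 'e \<Rightarrow> 'f) x. sF c (P x))"
    by standard (auto simp: fun_eq_iff F.scale_left_distrib F.scale_right_distrib)
  have nn: "poly_norm P \<ge> 0" if "P \<in> poly_space sE sF n" for P
    using order_trans[OF norm_ge_zero norm_le_poly_norm[OF that, of 0]] by simp
  have le: "poly_norm (\<lambda>x. sF c (P x)) \<le> norm c * poly_norm P" if "P \<in> poly_space sE sF n" for c P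
    by (rule poly_norm_le) (auto simp: F.norm_scale intro!: mult_left_mono norm_le_poly_norm[OF that])
  show ?thesis
  proof (intro seminormed_space.intro m seminormed_space_axioms.intro)
    show "module.subspace (\<lambda>c (P :: 'e \<Rightarrow> 'f) x. sF c (P x)) (poly_space sE sF n)"
      unfolding module.subspace_def[OF m]
      using poly_space_zero poly_space_add poly_space_scale
      by (auto simp: plus_fun_def zero_fun_def)
  next
    fix P Q assume PQ: "P \<in> poly_space sE sF n" "Q \<in> poly_space sE sF n"
    show "poly_norm (P + Q) \<le> poly_norm P + poly_norm Q"
      by (rule poly_norm_le)
        (use norm_le_poly_norm[OF PQ(1)] norm_le_poly_norm[OF PQ(2)] in
          \<open>auto intro!: norm_triangle_le add_mono\<close>)
  next
    fix P c assume P: "P \<in> poly_space sE sF n"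
    show "poly_norm (\<lambda>x. sF c (P x)) = norm c * poly_norm P"
    proof (cases "c = 0")
      case True
      then show ?thesis using le[OF P, of c] nn[OF poly_space_scale[OF P, of c]] by simp
    next
      case False
      \<comment> \<open>The inequality \<open>le\<close> for the inverse scalar gives the other half
        of the equality.\<close>
      then have "poly_norm P = poly_norm (\<lambda>x. sF (inverse c) (sF c (P x)))" by simp
      also have "\<dots> \<le> norm (inverse c) * poly_norm (\<lambda>x. sF c (P x))"
        by (rule le[OF poly_space_scale[OF P]])
      finally have "poly_norm P \<le> poly_norm (\<lambda>x. sF c (P x)) / norm c"
        by (simp only: norm_inverse divide_inverse mult.commute)
      then have "norm c * poly_norm P \<le> poly_norm (\<lambda>x. sF c (P x))"
        using False by (simp add: pos_le_divide_eq mult.commute)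
      then show ?thesis using le[OF P, of c] by simp
    qed
  qed (rule nn)
qed

section \<open>Composition of weakly continuous polynomials with bounded linear maps\<close>

lemma weakly_continuous_on_bounded_compose:
  assumes "weakly_continuous_on_bounded sE P" "bounded_linear T"
  shows "weakly_continuous_on_bounded sE (\<lambda>x. T (P x))"
  unfolding weakly_continuous_on_bounded_def
proof (intro allI impI)
  fix \<F> x assume "(\<exists>R. \<forall>\<^sub>F y in \<F>. norm y \<le> R) \<and> weakly_converges sE \<F> x"
  then have "((\<lambda>y. norm (P y - P x)) \<longlongrightarrow> 0) \<F>"
    using assms(1) unfolding weakly_continuous_on_bounded_def by blast
  then have "((\<lambda>y. norm (T (P y - P x))) \<longlongrightarrow> 0) \<F>"
    by (rule tendsto_norm_zero[OF bounded_linear.tendsto_zero[OF assms(2) tendsto_norm_zero_cancel]])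
  then show "((\<lambda>y. norm (T (P y) - T (P x))) \<longlongrightarrow> 0) \<F>"
    by (simp add: linear_diff[OF bounded_linear.linear[OF assms(2)]])
qed

text \<open>Used in both directions between scalar and \<open>F\<close>-valued polynomials: for
  \<open>c \<mapsto> sF c y\<close> and for a functional on \<open>F\<close>.\<close>

lemma wpoly_space_compose:
  fixes sG :: "'k \<Rightarrow> 'g::real_normed_vector \<Rightarrow> 'g"
  assumes "P \<in> wpoly_space sE sF n" "Vector_Spaces.linear sF sG T" "bounded_linear T"
  shows "(\<lambda>x. T (P x)) \<in> wpoly_space sE sG n"
  using assms by (auto simp: wpoly_space_def intro: poly_space_compose weakly_continuous_on_bounded_compose)

end

section \<open>Scalar polynomials: products with functionals and restriction to lines\<close>

context normed_space_over
begin

lemma poly_pair_scalar: "poly_pair scale (*)"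
  by (intro poly_pair.intro normed_space_over_axioms normed_space_over_scalars)

text \<open>The functional takes the new argument, with index \<open>k\<close>, on which the given
  \<open>k\<close>-linear form \<open>A\<close> does not depend.\<close>

lemma homogeneous_polynomial_functional_mult:
  assumes "homogeneous_polynomial scale (*) k P" and \<phi>: "\<phi> \<in> dual_space scale UNIV norm"
  shows "homogeneous_polynomial scale (*) (Suc k) (\<lambda>x. \<phi> x * P x)"
proof -
  interpret poly_pair scale "(*)" by (rule poly_pair_scalar)
  obtain A where A: "multilinear scale (*) k A" "\<And>x. P x = A (\<lambda>_. x)"
    using assms unfolding homogeneous_polynomial_def by auto
  have add: "\<phi> (x + y) = \<phi> x + \<phi> y" and hom: "\<phi> (scale c x) = c * \<phi> x" for x y c
    using \<phi> unfolding dual_space_def by blast+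
  have dep: "A x = A y" if "\<And>i. i < k \<Longrightarrow> x i = y i" for x y
    using A(1) that unfolding multilinear_iff by blast
  have last: "A (x(k := u)) = A x" for x u by (rule dep) simp
  have Aadd: "A (x(i := u + v)) = A (x(i := u)) + A (x(i := v))"
    and Ahom: "A (x(i := scale c u)) = c * A (x(i := u))" if "i < k" for x i u v c
    using A(1) that unfolding multilinear_iff by blast+
  have "multilinear scale (*) (Suc k) (\<lambda>x. \<phi> (x k) * A x)"
    unfolding multilinear_iff
  proof (intro conjI allI impI)
    fix x y :: "nat \<Rightarrow> 'e" assume "\<forall>i<Suc k. x i = y i"
    then show "\<phi> (x k) * A x = \<phi> (y k) * A y" using dep[of x y] by simp
  next
    fix x :: "nat \<Rightarrow> 'e" and i u v assume "i < Suc k"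
    then consider "i < k" | "i = k" by linarith
    then show "\<phi> ((x(i := u + v)) k) * A (x(i := u + v)) =
      \<phi> ((x(i := u)) k) * A (x(i := u)) + \<phi> ((x(i := v)) k) * A (x(i := v))"
      by cases (simp_all add: Aadd last add distrib_left distrib_right)
  next
    fix x :: "nat \<Rightarrow> 'e" and i u c assume "i < Suc k"
    then consider "i < k" | "i = k" by linarith
    then show "\<phi> ((x(i := scale c u)) k) * A (x(i := scale c u)) =
      c * (\<phi> ((x(i := u)) k) * A (x(i := u)))"
      by cases (simp_all add: Ahom last hom)
  qed
  then show ?thesis unfolding homogeneous_polynomial_def using A(2) by auto
qed

lemma poly_space_functional_power_mult:
  assumes "P \<in> poly_space scale (*) k" and \<phi>: "\<phi> \<in> dual_space scale UNIV norm"
  shows "(\<lambda>x. \<phi> x ^ m * P x) \<in> poly_space scale (*) (m + k)"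
proof (induction m)
  case 0
  then show ?case using assms by simp
next
  case (Suc m)
  have "continuous_on UNIV \<phi>"
    using dual_space_bounded_linear[OF \<phi>] by (rule linear_continuous_on)
  with Suc show ?case
    using homogeneous_polynomial_functional_mult[OF _ \<phi>, of "m + k" "\<lambda>x. \<phi> x ^ m * P x"]
    by (auto simp: poly_space_def mult.assoc intro!: continuous_intros)
qed

text \<open>Multiples of these powers are the elements of the M-ideal to which the two-ball property
  is applied.\<close>

lemma functional_power_in_wpoly_space:
  assumes \<phi>: "\<phi> \<in> dual_space scale UNIV norm"
  shows "(\<lambda>x. \<phi> x ^ n) \<in> wpoly_space scale (*) n"
proof -
  interpret poly_pair scale "(*)" by (rule poly_pair_scalar)
  \<comment> \<open>The power is treated as its own product with the constant 1, a polynomial of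
    degree 0.\<close>
  have "multilinear scale (*) 0 (\<lambda>_. 1)" unfolding multilinear_iff by simp
  then have "(\<lambda>_. 1) \<in> poly_space scale (*) 0"
    unfolding poly_space_def homogeneous_polynomial_def by auto
  from poly_space_functional_power_mult[OF this \<phi>, of n]
  have "(\<lambda>x. \<phi> x ^ n) \<in> poly_space scale (*) n" by simp
  moreover have "((\<lambda>y. norm (\<phi> y ^ n - \<phi> x ^ n)) \<longlongrightarrow> 0) \<F>" if "weakly_converges scale \<F> x" for \<F> x
  proof -
    have "(\<phi> \<longlongrightarrow> \<phi> x) \<F>" using that \<phi> unfolding weakly_converges_def by blast
    then have "((\<lambda>y. \<phi> y ^ n) \<longlongrightarrow> \<phi> x ^ n) \<F>" by (rule tendsto_power)
    then show ?thesis by (simp add: tendsto_norm_zero_iff LIM_zero_iff)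
  qed
  ultimately show ?thesis unfolding wpoly_space_def weakly_continuous_on_bounded_def by blast
qed

text \<open>Expanding the form \<open>A\<close> in one argument raises the degree in
  \<open>r\<close> by at most one. The resulting bound \<open>k\<close> is the same for all
  \<open>y\<close>, as the limit argument for the coefficients requires.\<close>

lemma homogeneous_polynomial_on_line:
  assumes "homogeneous_polynomial scale (*) k P"
  obtains c where "\<And>r. P (y + scale r z) = (\<Sum>j\<le>k. c j * r ^ j)"
proof -
  interpret poly_pair scale "(*)" by (rule poly_pair_scalar)
  obtain A where A: "multilinear scale (*) k A" "\<And>x. P x = A (\<lambda>_. x)"
    using assms unfolding homogeneous_polynomial_def by auto
  have Aadd: "A (x(i := u + v)) = A (x(i := u)) + A (x(i := v))"
    and Ahom: "A (x(i := scale c u)) = c * A (x(i := u))" if "i < k" for x i u v c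
    using A(1) that unfolding multilinear_iff by blast+
  have "\<exists>c. \<forall>r. A (\<lambda>i. if i < m then y + scale r z else w i) = (\<Sum>j\<le>m. c j * r ^ j)" if "m \<le> k" for m w
    using that
  proof (induction m arbitrary: w)
    case 0
    show ?case by (intro exI[of _ "\<lambda>_. A w"]) simp
  next
    case (Suc m)
    let ?a = "\<lambda>r w i. if i < m then y + scale r z else w i"
    obtain c d where c: "\<And>r. A (?a r (w(m := y))) = (\<Sum>j\<le>m. c j * r ^ j)"
      and d: "\<And>r. A (?a r (w(m := z))) = (\<Sum>j\<le>m. d j * r ^ j)"
      using Suc.IH[of "w(m := y)"] Suc.IH[of "w(m := z)"] Suc.prems by auto
    \<comment> \<open>These are the coefficients of the sum of the first polynomial and
      \<open>r\<close> times the second, so those of \<open>d\<close> are shifted by one.\<close>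
    define e where "e j = (if j \<le> m then c j else 0) + (case j of 0 \<Rightarrow> 0 | Suc i \<Rightarrow> d i)" for j
    have "A (\<lambda>i. if i < Suc m then y + scale r z else w i) = (\<Sum>j\<le>Suc m. e j * r ^ j)" for r
    proof -
      have 1: "(\<lambda>i. if i < Suc m then y + scale r z else w i) = (?a r w)(m := y + scale r z)"
        by (auto simp: fun_eq_iff)
      have 2: "(?a r w)(m := v) = ?a r (w(m := v))" for v by (auto simp: fun_eq_iff)
      have "A ((?a r w)(m := y + scale r z)) = A ((?a r w)(m := y)) + r * A ((?a r w)(m := z))"
        using Suc.prems Aadd[of m "?a r w" y "scale r z"] Ahom[of m "?a r w" r z] by simp
      then have "A (\<lambda>i. if i < Suc m then y + scale r z else w i) =
        A (?a r (w(m := y))) + r * A (?a r (w(m := z)))"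
        unfolding 1 unfolding 2 .
      also have "\<dots> = (\<Sum>j\<le>m. c j * r ^ j) + (\<Sum>j\<le>m. d j * r ^ Suc j)"
        unfolding c d by (simp add: sum_distrib_left algebra_simps)
      also have "(\<Sum>j\<le>m. d j * r ^ Suc j) = (\<Sum>j\<le>Suc m. (case j of 0 \<Rightarrow> 0 | Suc i \<Rightarrow> d i) * r ^ j)"
        by (subst sum.atMost_Suc_shift) simp
      also have "(\<Sum>j\<le>m. c j * r ^ j) = (\<Sum>j\<le>Suc m. (if j \<le> m then c j else 0) * r ^ j)"
        by simp
      finally show ?thesis unfolding e_def by (simp add: sum.distrib distrib_right)
    qed
    then show ?case by blast
  qed
  from this[of k "\<lambda>_. 0"] obtain c where c: "\<And>r. A (\<lambda>i. if i < k then y + scale r z else 0) = (\<Sum>j\<le>k. c j * r ^ j)"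
    by auto
  have "A (\<lambda>i. if i < k then y + scale r z else 0) = A (\<lambda>_. y + scale r z)" for r
    using A(1) unfolding multilinear_iff by auto
  then show ?thesis using that[of c] c A(2) by simp
qed

end

text \<open>The combination \<open>2\<^sup>k p(r) - p(2 r)\<close> removes the term of degree \<open>k\<close>.\<close>

lemma constant_coeff_tendsto_0:
  fixes a :: "nat \<Rightarrow> 'a \<Rightarrow> 'k::real_normed_field"
  assumes "\<And>r. r \<noteq> 0 \<Longrightarrow> ((\<lambda>y. \<Sum>j\<le>k. a j y * r ^ j) \<longlongrightarrow> 0) \<F>"
  shows "(a 0 \<longlongrightarrow> 0) \<F>"
  using assms
proof (induction k arbitrary: a)
  case 0
  then show ?case using 0[of 1] by simp
next
  case (Suc k)
  define b where "b j y = a j y * (2 ^ Suc k - 2 ^ j)" for j y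
  have "((\<lambda>y. \<Sum>j\<le>k. b j y * r ^ j) \<longlongrightarrow> 0) \<F>" if "r \<noteq> 0" for r
  proof -
    have "(\<Sum>j\<le>k. b j y * r ^ j) =
      2 ^ Suc k * (\<Sum>j\<le>Suc k. a j y * r ^ j) - (\<Sum>j\<le>Suc k. a j y * (2 * r) ^ j)" for y
    proof -
      have "2 ^ Suc k * (\<Sum>j\<le>Suc k. a j y * r ^ j) - (\<Sum>j\<le>Suc k. a j y * (2 * r) ^ j) =
        (\<Sum>j\<le>Suc k. b j y * r ^ j)"
        unfolding b_def sum_distrib_left sum_subtractf[symmetric]
        by (intro sum.cong) (auto simp: power_mult_distrib algebra_simps)
      also have "\<dots> = (\<Sum>j\<le>k. b j y * r ^ j)" by (simp add: b_def)
      finally show ?thesis by simp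
    qed
    moreover have "((\<lambda>y. 2 ^ Suc k * (\<Sum>j\<le>Suc k. a j y * r ^ j) - (\<Sum>j\<le>Suc k. a j y * (2 * r) ^ j))
        \<longlongrightarrow> 2 ^ Suc k * 0 - 0) \<F>"
      using that by (intro tendsto_diff tendsto_mult tendsto_const Suc.prems) auto
    ultimately show ?thesis by simp
  qed
  then have "(b 0 \<longlongrightarrow> 0) \<F>" by (rule Suc.IH)
  \<comment> \<open>The constant term survives with the factor \<open>e\<close>, which a comparison
    of norms shows to be nonzero.\<close>
  define e :: 'k where "e = 2 ^ Suc k - 1"
  have "norm ((2::'k) ^ Suc k) = 2 ^ Suc k" by (simp add: norm_mult norm_power)
  moreover have "(2::real) ^ Suc k \<noteq> 1" using one_less_power[of "2::real" "Suc k"] by simp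
  ultimately have "e \<noteq> 0" unfolding e_def by (metis eq_iff_diff_eq_0 norm_one)
  have "((\<lambda>y. b 0 y * inverse e) \<longlongrightarrow> 0 * inverse e) \<F>"
    by (intro tendsto_mult tendsto_const \<open>(b 0 \<longlongrightarrow> 0) \<F>\<close>)
  moreover have "(\<lambda>y. b 0 y * inverse e) = a 0"
    using \<open>e \<noteq> 0\<close> unfolding b_def e_def by (auto simp: fun_eq_iff mult.assoc)
  ultimately show ?case by simp
qed


section \<open>M-ideals of weakly continuous polynomials\<close>

context poly_pair
begin

text \<open>The unit vector \<open>y\<close> embeds the scalar polynomials isometrically into the
  \<open>F\<close>-valued ones, and \<open>h\<close> leads back without increasing norms. Thus the
  M-ideal property for \<open>F\<close> yields information on scalar polynomials.\<close>

lemma functional_power_mult_in_wpoly_space: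
  assumes M: "M_ideal (\<lambda>c P x. sF c (P x)) (poly_space sE sF n) poly_norm (wpoly_space sE sF n)"
    and y: "norm y = 1" and h: "h \<in> dual_space sF UNIV norm" "\<And>v. norm (h v) \<le> norm v" "h y = 1"
    and \<phi>: "\<phi> \<in> dual_space sE UNIV norm" "\<And>x. norm (\<phi> x) \<le> norm x"
    and P: "P \<in> poly_space sE (*) k" and "k < n"
  shows "(\<lambda>x. \<phi> x ^ (n - k) * P x) \<in> wpoly_space sE (*) n"
proof (rule ccontr)
  interpret S: poly_pair sE "(*)" by (rule E.poly_pair_scalar)
  interpret seminormed_space "\<lambda>c P x. sF c (P x)" "poly_space sE sF n" poly_norm
    by (rule seminormed_space_poly)
  define q where "q x = \<phi> x ^ (n - k) * P x" for x
  define W where "W = wpoly_space sE ((*) :: 'k \<Rightarrow> 'k \<Rightarrow> 'k) n"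
  assume "(\<lambda>x. \<phi> x ^ (n - k) * P x) \<notin> wpoly_space sE (*) n"
  then have qW: "q \<notin> W" unfolding q_def W_def .
  have q: "q \<in> poly_space sE (*) n"
    using E.poly_space_functional_power_mult[OF P \<phi>(1), of "n - k"] \<open>k < n\<close> unfolding q_def by simp
  have Wp: "w \<in> poly_space sE (*) n" if "w \<in> W" for w using that unfolding W_def wpoly_space_def by simp
  have K: "vector_space ((*) :: 'k \<Rightarrow> 'k \<Rightarrow> 'k)"
    by (rule normed_space_over.axioms(1)[OF normed_space_over_scalars])
  have "Vector_Spaces.linear (*) (*) ((*) c)" for c :: 'k
    unfolding Vector_Spaces.linear_iff
    using K by (auto simp: algebra_simps)
  then have Wc: "(\<lambda>x. c * w x) \<in> W" if "w \<in> W" for c w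
    using S.wpoly_space_compose[OF _ _ bounded_linear_mult_right] that unfolding W_def by blast
  have \<phi>W: "(\<lambda>x. \<phi> x ^ n) \<in> W" unfolding W_def by (rule E.functional_power_in_wpoly_space[OF \<phi>(1)])
  have tlin: "Vector_Spaces.linear (*) sF (\<lambda>c. sF c y)"
    unfolding Vector_Spaces.linear_iff
    using K F.vector_space_axioms by (auto simp: F.scale_left_distrib)
  have tp: "(\<lambda>x. sF (w x) y) \<in> poly_space sE sF n" if "w \<in> poly_space sE (*) n" for w
    using S.poly_space_compose[OF that tlin F.bounded_linear_scale_left] .
  have tW: "(\<lambda>x. sF (w x) y) \<in> wpoly_space sE sF n" if "w \<in> W" for w
    using S.wpoly_space_compose[OF that[unfolded W_def] tlin F.bounded_linear_scale_left] .
  have hW: "(\<lambda>x. h (w x)) \<in> W" if "w \<in> wpoly_space sE sF n" for w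
    unfolding W_def
    using wpoly_space_compose[OF that F.dual_space_linear[OF h(1)] F.dual_space_bounded_linear[OF h(1)]] .
  have hs: "h (sF c v) = c * h v" and ha: "h (u + v) = h u + h v" for c u v
    using h(1) unfolding dual_space_def by blast+
  have hd: "h (u - v) = h u - h v" for u v using ha[of "u - v" v] by simp
  have diff: "(\<lambda>x. q x - w x) \<in> poly_space sE (*) n" if "w \<in> W" for w
    using S.poly_space_diff[OF q Wp[OF that]] .
  define d where "d = (INF w\<in>W. poly_norm (\<lambda>x. q x - w x))"
  have Wne: "W \<noteq> {}" using \<phi>W by blast
  have nn: "poly_norm p \<ge> 0" if "p \<in> poly_space sE ((*) :: 'k \<Rightarrow> 'k \<Rightarrow> 'k) n" for p
    using order_trans[OF norm_ge_zero S.norm_le_poly_norm[OF that, of 0]] by simp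
  have bdd: "bdd_below ((\<lambda>w. poly_norm (\<lambda>x. q x - w x)) ` W)"
    using nn diff by (auto simp: bdd_below_def)
  have dle: "d \<le> poly_norm (\<lambda>x. q x - w x)" if "w \<in> W" for w
    unfolding d_def using that by (intro cINF_lower bdd)
  have near: "\<exists>w\<in>W. poly_norm (\<lambda>x. q x - w x) < d + \<delta>" if "\<delta> > 0" for \<delta>
    using cINF_less_iff[OF Wne bdd, of "d + \<delta>"] that unfolding d_def by simp
  \<comment> \<open>Distance 0 would make \<open>q\<close> times \<open>y\<close> a limit of
    elements of the closed subspace \<open>wpoly_space sE sF n\<close>, hence an element of it;
    applying \<open>h\<close> would then place \<open>q\<close> in \<open>W\<close>.\<close>
  have "d \<noteq> 0"
  proof
    assume "d = 0"
    then have "\<exists>w\<in>W. poly_norm (\<lambda>x. q x - w x) < inverse (Suc i)" for i :: nat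
      using near[of "inverse (Suc i)"] by simp
    then obtain w where w: "\<And>i. w i \<in> W" "\<And>i. poly_norm (\<lambda>x. q x - w i x) < inverse (Suc i)"
      by metis
    define u where "u i = (\<lambda>x. sF (w i x) y)" for i
    define v where "v = (\<lambda>x. sF (q x) y)"
    have u: "u i \<in> wpoly_space sE sF n" for i unfolding u_def using w tW by blast
    have v: "v \<in> poly_space sE sF n" unfolding v_def using q tp by blast
    have "poly_norm (u i - v) \<le> inverse (Suc i)" for i
    proof (rule poly_norm_le)
      fix x :: 'e assume x: "norm x \<le> 1"
      have "norm ((u i - v) x) = norm (q x - w i x)"
        by (simp add: u_def v_def F.norm_scale y norm_minus_commute flip: F.scale_left_diff_distrib)
      also have "\<dots> \<le> poly_norm (\<lambda>x. q x - w i x)" using S.norm_le_poly_norm[OF diff x] w by blast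
      finally show "norm ((u i - v) x) \<le> inverse (Suc i)" using w(2)[of i] by simp
    qed
    moreover have "0 \<le> poly_norm (u i - v)" for i
    proof -
      have "u i - v \<in> poly_space sE sF n"
        using poly_space_diff[OF _ v, of "u i"] u[of i] by (simp add: wpoly_space_def fun_diff_def)
      then show ?thesis by (rule N_nonneg)
    qed
    ultimately have "(\<lambda>i. poly_norm (u i - v)) \<longlonglongrightarrow> 0"
      by (intro real_tendsto_sandwich[OF _ _ tendsto_const LIMSEQ_inverse_real_of_nat]) auto
    then have "v \<in> wpoly_space sE sF n"
      using M u v unfolding M_ideal_def closed_subspace_def by blast
    from hW[OF this] show False using qW by (simp add: v_def hs h)
  qed
  moreover have "d \<ge> 0" unfolding d_def using nn diff Wne by (intro cINF_greatest) auto
  ultimately have d: "d > 0" by simp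
  define C where "C = poly_norm P + 1"
  interpret Pk: seminormed_space "\<lambda>c P x. c * P x" "poly_space sE ((*) :: 'k \<Rightarrow> 'k \<Rightarrow> 'k) k" poly_norm
    by (rule S.seminormed_space_poly)
  have C: "C > 0" "\<And>x. norm x \<le> 1 \<Longrightarrow> norm (P x) \<le> C"
    using Pk.N_nonneg[OF P] S.norm_le_poly_norm[OF P] unfolding C_def by force+
  have \<phi>1: "norm (\<phi> x) \<le> 1" if "norm x \<le> 1" for x using \<phi>(2)[of x] that by linarith
  \<comment> \<open>As \<open>n - k \<ge> 1\<close>, at least one factor \<open>\<phi> x\<close> is
    left, so \<open>q\<close> is small wherever \<open>\<phi>\<close> is.\<close>
  have qC: "norm (q x) \<le> norm (\<phi> x) * C" if x: "norm x \<le> 1" for x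
  proof -
    have "norm (\<phi> x) ^ (n - k) \<le> norm (\<phi> x) ^ 1"
      using \<phi>1[OF x] \<open>k < n\<close> by (intro power_decreasing) auto
    then show ?thesis unfolding q_def norm_mult norm_power
      using C(2)[OF x] by (intro mult_mono) auto
  qed
  \<comment> \<open>\<open>\<alpha>\<close> is a lower bound for \<open>norm (\<phi> x)\<close> at
    points of the ball where \<open>norm (q x) > d / 2\<close>, and \<open>\<kappa>\<close> is the
    resulting one for \<open>(d * norm (\<phi> x) ^ n)\<^sup>2\<close>.\<close>
  define \<alpha> where "\<alpha> = d / (2 * C)"
  define \<kappa> where "\<kappa> = d\<^sup>2 * \<alpha> ^ (2 * n)"
  have \<alpha>: "\<alpha> > 0" "\<kappa> > 0" using d C(1) by (auto simp: \<alpha>_def \<kappa>_def)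
  \<comment> \<open>\<open>t * D\<close> will bound
    \<open>(d + \<epsilon>)\<^sup>2 - (d - t * C)\<^sup>2\<close>, and the choice of
    \<open>t\<close> keeps it below \<open>\<kappa>\<close>.\<close>
  define D where "D = (d / 4 + C) * (3 * d)"
  have D: "D > 0" unfolding D_def using d C(1) by simp
  define t where "t = min (min 1 (d / C)) (\<kappa> / (2 * D))"
  have t: "t > 0" "t \<le> 1" "t * C \<le> d" "t * D < \<kappa>"
  proof -
    show "t > 0" unfolding t_def using d C(1) D \<alpha> by simp
    show "t \<le> 1" unfolding t_def by simp
    have "t \<le> d / C" unfolding t_def by simp
    then show "t * C \<le> d" using C(1) by (simp add: pos_le_divide_eq)
    have "t \<le> \<kappa> / (2 * D)" unfolding t_def by simp
    then have "t * (2 * D) \<le> \<kappa>" using D by (subst (asm) pos_le_divide_eq) auto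
    then show "t * D < \<kappa>" using \<alpha>(2) by linarith
  qed
  \<comment> \<open>With this value the total loss \<open>2 * \<epsilon>\<close> is only half of the
    gain \<open>t * d\<close>.\<close>
  define \<epsilon> where "\<epsilon> = t * d / 4"
  have \<epsilon>: "\<epsilon> > 0" unfolding \<epsilon>_def using t d by simp
  define Q where "Q = (\<lambda>x. sF (q x) y)"
  define j where "j = (\<lambda>x. sF (of_real d * \<phi> x ^ n) y)"
  have jJ: "j \<in> wpoly_space sE sF n" unfolding j_def by (rule tW[OF Wc[OF \<phi>W]])
  have jd: "poly_norm j \<le> d"
  proof (rule poly_norm_le)
    fix x :: 'e assume "norm x \<le> 1"
    then have "norm (\<phi> x) ^ n \<le> 1" by (intro power_le_one \<phi>1) auto
    then show "norm (j x) \<le> d"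
      unfolding j_def F.norm_scale y norm_mult norm_power using d by simp
  qed
  have "\<exists>w\<in>wpoly_space sE sF n. poly_norm (Q - w) \<le> d + \<delta>" if \<delta>: "\<delta> > 0" for \<delta>
  proof -
    obtain w where w: "w \<in> W" "poly_norm (\<lambda>x. q x - w x) < d + \<delta>" using near[OF \<delta>] by blast
    have "poly_norm (Q - (\<lambda>x. sF (w x) y)) \<le> d + \<delta>"
    proof (rule poly_norm_le)
      fix x :: 'e assume x: "norm x \<le> 1"
      have "norm ((Q - (\<lambda>x. sF (w x) y)) x) = norm (q x - w x)"
        by (simp add: Q_def F.norm_scale y flip: F.scale_left_diff_distrib)
      also have "\<dots> \<le> poly_norm (\<lambda>x. q x - w x)" using S.norm_le_poly_norm[OF diff x] w by blast
      finally show "norm ((Q - (\<lambda>x. sF (w x) y)) x) \<le> d + \<delta>" using w(2) by simp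
    qed
    then show ?thesis using tW[OF w(1)] by blast
  qed
  then obtain w where w: "w \<in> wpoly_space sE sF n" and
    wp: "poly_norm (Q + j - w) \<le> d + \<epsilon>" and wm: "poly_norm (Q - j - w) \<le> d + \<epsilon>"
    using M_ideal_two_ball[OF M tp[OF q, folded Q_def] jJ jd _ \<epsilon>] by blast
  define R where "R x = q x - h (w x)" for x
  have QP: "Q \<in> poly_space sE sF n" "j \<in> poly_space sE sF n" "w \<in> poly_space sE sF n"
    using tp[OF q] jJ w unfolding Q_def wpoly_space_def by auto
  \<comment> \<open>\<open>h\<close> maps the values of \<open>Q + j - w\<close> and
    \<open>Q - j - w\<close> at \<open>x\<close> to \<open>R x + ?b\<close> and
    \<open>R x - ?b\<close>. The parallelogram law combines the two estimates.\<close>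
  have bound: "(norm (R x))\<^sup>2 + (d * norm (\<phi> x) ^ n)\<^sup>2 \<le> (d + \<epsilon>)\<^sup>2" if x: "norm x \<le> 1" for x
  proof -
    let ?b = "of_real d * \<phi> x ^ n"
    have "Q + j - w \<in> poly_space sE sF n"
      using poly_space_diff[OF poly_space_add[OF QP(1,2)] QP(3)]
      by (simp add: fun_diff_def plus_fun_def)
    from order_trans[OF norm_le_poly_norm[OF this x] wp]
    have "norm (h ((Q + j - w) x)) \<le> d + \<epsilon>" using h(2) order_trans by blast
    then have 1: "norm (R x + ?b) \<le> d + \<epsilon>"
      by (simp add: hd ha hs h(3) Q_def j_def R_def algebra_simps)
    have "Q - j - w \<in> poly_space sE sF n"
      using poly_space_diff[OF poly_space_diff[OF QP(1,2)] QP(3)]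
      by (simp add: fun_diff_def)
    from order_trans[OF norm_le_poly_norm[OF this x] wm]
    have "norm (h ((Q - j - w) x)) \<le> d + \<epsilon>" using h(2) order_trans by blast
    then have 2: "norm (R x - ?b) \<le> d + \<epsilon>"
      by (simp add: hd ha hs h(3) Q_def j_def R_def algebra_simps)
    have "norm ?b = d * norm (\<phi> x) ^ n" using d by (simp add: norm_mult norm_power)
    then show ?thesis
      using parallelogram_scalar[of "R x" ?b] power_mono[OF 1 norm_ge_zero, of 2]
        power_mono[OF 2 norm_ge_zero, of 2] by simp
  qed
  \<comment> \<open>\<open>R + t q\<close> is \<open>1 + t\<close> times the difference of
    \<open>q\<close> and an element of \<open>W\<close>, so its supremum on the ball is at least
    \<open>(1 + t) * d\<close>.\<close>
  have "\<exists>x. norm x \<le> 1 \<and> norm (R x + of_real t * q x) > (1 + t) * d - \<epsilon>"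
  proof (rule ccontr)
    assume "\<not> ?thesis"
    then have le: "norm (R x + of_real t * q x) \<le> (1 + t) * d - \<epsilon>" if "norm x \<le> 1" for x
      using that by (auto simp: not_less)
    define w' where "w' x = of_real (1 / (1 + t)) * h (w x)" for x
    have "w' \<in> W" unfolding w'_def by (rule Wc[OF hW[OF w]])
    have "poly_norm (\<lambda>x. q x - w' x) \<le> d - \<epsilon> / (1 + t)"
    proof (rule poly_norm_le)
      fix x :: 'e assume x: "norm x \<le> 1"
      have "of_real (1 + t) * w' x = of_real ((1 + t) * (1 / (1 + t))) * h (w x)"
        unfolding w'_def of_real_mult by (simp only: mult.assoc)
      also have "\<dots> = h (w x)" using t(1) by simp
      finally have "of_real (1 + t) * (q x - w' x) = R x + of_real t * q x"
        by (simp add: R_def algebra_simps)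
      then have "(1 + t) * norm (q x - w' x) = norm (R x + of_real t * q x)"
        using t(1) by (metis norm_mult norm_of_real abs_of_pos add_pos_pos zero_less_one)
      then have "(1 + t) * norm (q x - w' x) \<le> (1 + t) * d - \<epsilon>" using le[OF x] by simp
      then show "norm (q x - w' x) \<le> d - \<epsilon> / (1 + t)" using t(1) by (simp add: field_simps)
    qed
    then have "d \<le> d - \<epsilon> / (1 + t)" using dle[OF \<open>w' \<in> W\<close>] by linarith
    then show False using \<epsilon> t(1) by (simp add: field_simps)
  qed
  then obtain x where x: "norm x \<le> 1" and big: "norm (R x + of_real t * q x) > (1 + t) * d - \<epsilon>"
    by blast
  define a where "a = norm (R x)"
  define b where "b = norm (q x)"
  define s where "s = norm (\<phi> x)"
  have s: "0 \<le> s" "s \<le> 1" unfolding s_def using \<phi>1[OF x] by auto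
  have "norm (R x + of_real t * q x) \<le> a + t * b"
    unfolding a_def b_def using norm_triangle_ineq[of "R x" "of_real t * q x"] t(1)
    by (simp add: norm_mult)
  with big have ab: "(1 + t) * d - \<epsilon> < a + t * b" by linarith
  have sq: "a\<^sup>2 + (d * s ^ n)\<^sup>2 \<le> (d + \<epsilon>)\<^sup>2" using bound[OF x] unfolding a_def s_def .
  have a: "a \<le> d + \<epsilon>"
  proof (rule power2_le_imp_le)
    show "a\<^sup>2 \<le> (d + \<epsilon>)\<^sup>2" using sq zero_le_power2[of "d * s ^ n"] by linarith
  qed (use d \<epsilon> in simp)
  have bC: "b \<le> s * C" using qC[OF x] unfolding b_def s_def .
  \<comment> \<open>Since \<open>a \<le> d + \<epsilon>\<close>, the term \<open>t * b\<close> must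
    contribute more than \<open>t * d - 2 * \<epsilon> = t * (d / 2)\<close>.\<close>
  have "t * b > t * (d / 2)" using ab a unfolding \<epsilon>_def by (simp add: algebra_simps)
  then have "d / 2 < b" using t(1) by simp
  then have "\<alpha> \<le> s" using bC C(1) unfolding \<alpha>_def by (simp add: field_simps)
  then have "(d * \<alpha> ^ n)\<^sup>2 \<le> (d * s ^ n)\<^sup>2"
    using \<alpha>(1) d by (intro power_mono mult_left_mono) auto
  then have "\<kappa> \<le> (d * s ^ n)\<^sup>2"
    unfolding \<kappa>_def by (simp add: power_mult_distrib power_mult mult.commute[of 2 n])
  then have k1: "\<kappa> \<le> (d + \<epsilon>)\<^sup>2 - a\<^sup>2" using sq by simp
  \<comment> \<open>On the other hand, \<open>b \<le> C\<close> leaves at least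
    \<open>d - t * C\<close> for \<open>a\<close>, so the room
    \<open>(d + \<epsilon>)\<^sup>2 - a\<^sup>2\<close> for \<open>\<phi>\<close> is at most of
    order \<open>t\<close>.\<close>
  have "b \<le> C" using bC mult_right_mono[OF s(2), of C] C(1) by linarith
  then have "t * b \<le> t * C" using t(1) by simp
  moreover have "(1 + t) * d - \<epsilon> = d + 3 * \<epsilon>" unfolding \<epsilon>_def by (simp add: field_simps)
  ultimately have "d - t * C \<le> a" using ab \<epsilon> by linarith
  then have "(d - t * C)\<^sup>2 \<le> a\<^sup>2" using t(3) by (intro power_mono) auto
  then have "\<kappa> \<le> (d + \<epsilon>)\<^sup>2 - (d - t * C)\<^sup>2" using k1 by simp
  \<comment> \<open>A difference of squares, with
    \<open>\<epsilon> + t * C = t * (d / 4 + C)\<close>.\<close>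
  also have "\<dots> = t * (d / 4 + C) * (2 * d + (\<epsilon> - t * C))"
    unfolding \<epsilon>_def by (simp add: power2_eq_square algebra_simps)
  also have "\<dots> \<le> t * (d / 4 + C) * (3 * d)"
  proof (rule mult_left_mono)
    have "\<epsilon> \<le> d" unfolding \<epsilon>_def using mult_right_mono[OF t(2), of d] d by simp
    then show "2 * d + (\<epsilon> - t * C) \<le> 3 * d" using mult_pos_pos[OF t(1) C(1)] by linarith
  qed (use t(1) d C(1) in simp)
  also have "\<dots> < \<kappa>" using t(4) by (simp add: D_def mult.assoc)
  finally show False by simp
qed

end

section \<open>From the products with functionals back to the polynomial\<close>

text \<open>Away from \<open>0\<close> one divides by \<open>\<phi>\<^sup>m\<close>. Continuity at \<open>0\<close> is then recovered from
  continuity at the points \<open>r z\<close>, \<open>r \<noteq> 0\<close>, since \<open>r \<mapsto> P (y + r z)\<close> is a polynomial of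
  bounded degree.\<close>

lemma weakly_continuous_if_functional_power_mult:
  fixes sE :: "'k::real_or_complex \<Rightarrow> 'e::banach \<Rightarrow> 'e"
  assumes E: "banach_space_over sE" and P: "P \<in> poly_space sE (*) k"
    and wc: "\<And>\<phi>. \<phi> \<in> dual_space sE UNIV norm \<Longrightarrow> (\<And>x. norm (\<phi> x) \<le> norm x) \<Longrightarrow>
      weakly_continuous_on_bounded sE (\<lambda>x. \<phi> x ^ m * P x)"
  shows "weakly_continuous_on_bounded sE P"
proof -
  interpret E: banach_space_over sE by (rule E)
  interpret normed_space_over sE by (rule E.normed_space_over)
  have nz: "(P \<longlongrightarrow> P x) \<F>"
    if \<F>: "\<exists>R. \<forall>\<^sub>F y in \<F>. norm y \<le> R" "weakly_converges sE \<F> x" and x: "x \<noteq> 0" for \<F> x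
  proof -
    obtain \<phi> where \<phi>: "\<phi> \<in> dual_space sE UNIV norm" "\<And>v. norm (\<phi> v) \<le> norm v" "\<phi> x = of_real (norm x)"
      using norming_functional[OF E, of x] by blast
    have \<phi>x: "\<phi> x \<noteq> 0" using \<phi>(3) x by simp
    have 1: "(\<phi> \<longlongrightarrow> \<phi> x) \<F>" using \<F>(2) \<phi>(1) unfolding weakly_converges_def by blast
    have "((\<lambda>y. norm (\<phi> y ^ m * P y - \<phi> x ^ m * P x)) \<longlongrightarrow> 0) \<F>"
      using wc[OF \<phi>(1,2)] \<F> unfolding weakly_continuous_on_bounded_def by blast
    then have 2: "((\<lambda>y. \<phi> y ^ m * P y) \<longlongrightarrow> \<phi> x ^ m * P x) \<F>"
      by (simp add: tendsto_norm_zero_iff LIM_zero_iff)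
    have "((\<lambda>y. \<phi> y ^ m * P y / \<phi> y ^ m) \<longlongrightarrow> \<phi> x ^ m * P x / \<phi> x ^ m) \<F>"
      using \<phi>x by (intro tendsto_divide 2 tendsto_power 1) simp
    moreover have "\<forall>\<^sub>F y in \<F>. \<phi> y ^ m * P y / \<phi> y ^ m = P y"
      using tendsto_imp_eventually_ne[OF 1 \<phi>x] by eventually_elim simp
    ultimately show ?thesis using \<phi>x by (simp add: tendsto_cong)
  qed
  show ?thesis
    unfolding weakly_continuous_on_bounded_def
  proof (intro allI impI, elim conjE)
    fix \<F> x assume bd: "\<exists>R. \<forall>\<^sub>F y in \<F>. norm y \<le> R" and cv: "weakly_converges sE \<F> x"
    have "(P \<longlongrightarrow> P x) \<F>"
    proof (cases "x = 0")
      case False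
      then show ?thesis using nz bd cv by blast
    next
      case True
      show ?thesis
      proof (cases "\<exists>z::'e. z \<noteq> 0")
        \<comment> \<open>In the trivial space there is no direction \<open>z\<close>, but
          \<open>P\<close> is constant.\<close>
        case False
        then have "P = (\<lambda>_. P x)" by metis
        then show ?thesis by (metis tendsto_const)
      next
        case True
        then obtain z :: 'e where "z \<noteq> 0" by blast
        have "\<exists>c. \<forall>r. P (y + sE r z) = (\<Sum>j\<le>k. c j * r ^ j)" for y
          using homogeneous_polynomial_on_line[of k P y z] P unfolding poly_space_def by blast
        then obtain c where c: "\<And>y r. P (y + sE r z) = (\<Sum>j\<le>k. c y j * r ^ j)" by metis
        \<comment> \<open>At \<open>r = 0\<close> only the term with \<open>j = 0\<close> is left,
          as \<open>0 ^ 0 = 1\<close>.\<close>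
        have c0: "c y 0 = P y" for y
        proof -
          have "P y = (\<Sum>j\<le>k. c y j * 0 ^ j)" using c[of y 0] by simp
          also have "\<dots> = (\<Sum>j\<in>{0}. c y j * 0 ^ j)" by (rule sum.mono_neutral_right) auto
          finally show ?thesis by simp
        qed
        have "((\<lambda>y. \<Sum>j\<le>k. (c y j - c 0 j) * r ^ j) \<longlongrightarrow> 0) \<F>" if r: "r \<noteq> 0" for r
        proof -
          \<comment> \<open>Translating the filter by \<open>sE r z\<close> moves its weak limit
            from 0 to a nonzero point, where \<open>nz\<close> applies.\<close>
          define \<G> where "\<G> = filtermap (\<lambda>y. y + sE r z) \<F>"
          obtain R where R: "\<forall>\<^sub>F y in \<F>. norm y \<le> R" using bd by blast
          have "\<forall>\<^sub>F y in \<F>. norm (y + sE r z) \<le> R + norm (sE r z)"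
            using R by eventually_elim (simp add: norm_triangle_le)
          then have "\<exists>R. \<forall>\<^sub>F y in \<G>. norm y \<le> R" unfolding \<G>_def eventually_filtermap by blast
          moreover have "weakly_converges sE \<G> (sE r z)"
            unfolding weakly_converges_def
          proof
            fix \<phi> assume \<phi>: "\<phi> \<in> dual_space sE UNIV norm"
            then have "(\<phi> \<longlongrightarrow> \<phi> 0) \<F>" using cv \<open>x = 0\<close> unfolding weakly_converges_def by blast
            then have "((\<lambda>y. \<phi> y + \<phi> (sE r z)) \<longlongrightarrow> \<phi> 0 + \<phi> (sE r z)) \<F>"
              by (intro tendsto_add tendsto_const)
            moreover have "\<phi> (u + v) = \<phi> u + \<phi> v" for u v using \<phi> unfolding dual_space_def by blast
            moreover have "\<phi> 0 = 0" using calculation(2)[of 0 0] by simp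
            ultimately show "(\<phi> \<longlongrightarrow> \<phi> (sE r z)) \<G>" unfolding \<G>_def by (simp add: filterlim_filtermap)
          qed
          moreover have "sE r z \<noteq> 0" using r \<open>z \<noteq> 0\<close> by simp
          ultimately have "(P \<longlongrightarrow> P (sE r z)) \<G>" by (rule nz)
          then have "((\<lambda>y. P (y + sE r z) - P (0 + sE r z)) \<longlongrightarrow> 0) \<F>"
            unfolding \<G>_def by (simp add: filterlim_filtermap LIM_zero_iff)
          then show ?thesis unfolding c by (simp add: sum_subtractf left_diff_distrib)
        qed
        then have "((\<lambda>y. c y 0 - c 0 0) \<longlongrightarrow> 0) \<F>"
          using constant_coeff_tendsto_0[where k = k and a = "\<lambda>j y. c y j - c 0 j"] by blast
        then show ?thesis using \<open>x = 0\<close> by (simp add: c0 LIM_zero_iff)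
      qed
    qed
    then show "((\<lambda>y. norm (P y - P x)) \<longlongrightarrow> 0) \<F>" by (simp add: tendsto_norm_zero_iff LIM_zero_iff)
  qed
qed

section \<open>Comparison of the degree with the critical degree\<close>

theorem corollary1p9:
  fixes sE :: "'k::real_or_complex \<Rightarrow> 'e::banach \<Rightarrow> 'e"
    and sF :: "'k \<Rightarrow> 'f::banach \<Rightarrow> 'f"
    and n :: nat
  assumes "banach_space_over sE"
    and "banach_space_over sF"
    and "\<exists>y::'f. y \<noteq> 0"
    and "n \<ge> 1"
    and "M_ideal (\<lambda>c P x. sF c (P x)) (poly_space sE sF n) poly_norm (wpoly_space sE sF n)"
  shows "enat n \<le> critical_degree sE"
proof (rule ccontr)
  interpret E: banach_space_over sE by fact
  interpret F: banach_space_over sF by fact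
  interpret poly_pair sE sF
    by (intro poly_pair.intro E.normed_space_over F.normed_space_over)
  let ?K = "\<lambda>k. k \<ge> 1 \<and> wpoly_space sE (*) k \<noteq> poly_space sE (*) k"
  assume lt: "\<not> enat n \<le> critical_degree sE"
  then have ex: "\<exists>k\<ge>1. wpoly_space sE (*) k \<noteq> poly_space sE (*) k"
    unfolding critical_degree_def by (auto split: if_splits)
  \<comment> \<open>The negated inequality makes the critical degree finite; \<open>k\<close> is its
    value.\<close>
  define k where "k = (LEAST k. ?K k)"
  have "?K k" unfolding k_def by (rule LeastI_ex) (use ex in blast)
  moreover have "k < n" using lt ex unfolding critical_degree_def k_def by simp
  ultimately obtain P where P: "P \<in> poly_space sE (*) k" "\<not> weakly_continuous_on_bounded sE P"
    unfolding wpoly_space_def by blast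
  obtain y0 :: 'f where "y0 \<noteq> 0" using assms(3) by blast
  \<comment> \<open>The normalisation gives \<open>h y = 1\<close>, so that \<open>h\<close> inverts
    the embedding \<open>c \<mapsto> sF c y\<close>.\<close>
  define y where "y = y0 /\<^sub>R norm y0"
  have y: "norm y = 1" unfolding y_def using \<open>y0 \<noteq> 0\<close> by simp
  obtain h where h: "h \<in> dual_space sF UNIV norm" "\<And>v. norm (h v) \<le> norm v" "h y = of_real (norm y)"
    using norming_functional[OF assms(2), of y] by blast
  have "weakly_continuous_on_bounded sE (\<lambda>x. \<phi> x ^ (n - k) * P x)"
    if "\<phi> \<in> dual_space sE UNIV norm" "\<And>x. norm (\<phi> x) \<le> norm x" for \<phi>
    using functional_power_mult_in_wpoly_space[OF assms(5) y h(1,2) _ that P(1) \<open>k < n\<close>] h(3) y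
    by (simp add: wpoly_space_def)
  from weakly_continuous_if_functional_power_mult[OF assms(1) P(1) this] show False using P(2) by blast
qed

end
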